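(* Let $G=\langle A\mid R\rangle$ be a group given by a finite presentation. Then: (i) $G$ is coherent if and only if $G$ is eq-coherent; (ii) $G$ is effectively coherent if and only if $G$ is effectively eq-coherent.
   Context: A finitely presented group $G=\langle A\mid R\rangle$ is coherent if every finitely generated subgroup of $G$ is finitely presented. It is effectively coherent if it is coherent and there is an algorithm which, on input $h_1,\ldots,h_r\in G$ (given as words on $A$), computes a finite presentation for $H=\langle h_1,\ldots,h_r\rangle\leqslant G$ on the given generators $h_1,\ldots,h_r$; that is, it computes finitely many words $w_1,\ldots,w_s$ in the free group $\mathbb{F}_r$ on $x_1,\ldots,x_r$ whose normal closure in $\mathbb{F}_r$ is the kernel of the epimorphism $\mathbb{F}_r\to H$, $x_i\mapsto h_i$. For a subgroup $H\leqslant G$ and $g\in G$, let $H*\langle x\rangle$ be the free product of $H$ with the infinite cyclic group generated by a variable $x$. Elements $w(x)\in H*\langle x\rangle$ are called $H$-equations; $w(g)\in G$ denotes the image of $w(x)$ under the homomorphism $H*\langle x\rangle\to G$ that is the inclusion on $H$ and sends $x\mapsto g$. The ideal of $g$ over $H$ is the normal subgroup $I_H(g)=\{w(x)\in H*\langle x\rangle\mid w(g)=1\}$ of $H*\langle x\rangle$. A finitely presented group $G=\langle A\mid R\rangle$ is eq-coherent (equationally coherent) if, for every finitely generated subgroup $H\leqslant G$ and every $g\in G$, the ideal $I_H(g)$ is finitely generated as a normal subgroup of $H*\langle x\rangle$. It is effectively eq-coherent if it is eq-coherent and there is an algorithm which, on input $h_1,\ldots,h_r;g\in G$ (given as words on $A$),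 computes finitely many $H$-equations $w_1(x),\ldots,w_s(x)\in H*\langle x\rangle$ such that $I_H(g)$ is the normal closure of $\{w_1(x),\ldots,w_s(x)\}$ in $H*\langle x\rangle$, where $H=\langle h_1,\ldots,h_r\rangle$. *)

theory Defs
  imports "HOL-Algebra.Elementary_Groups" "HOL-Library.Nat_Bijection"
begin

section \<open>Words and free groups\<close>

text \<open>The letter \<open>(i, True)\<close> stands for \<open>x\<^sub>i\<close> and \<open>(i, False)\<close> for its formal inverse.\<close>

type_synonym 'i wd = "('i \<times> bool) list"

definition words :: "'i set \<Rightarrow> 'i wd set" where
  "words A = {w. fst ` set w \<subseteq> A}"

definition reduced :: "'i wd \<Rightarrow> bool" where
  "reduced w \<longleftrightarrow> successively (\<lambda>s t. \<not> (fst s = fst t \<and> snd s \<noteq> snd t)) w"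

fun push_letter :: "'i \<times> bool \<Rightarrow> 'i wd \<Rightarrow> 'i wd" where
  "push_letter s [] = [s]"
| "push_letter s (t # w) = (if fst s = fst t \<and> snd s \<noteq> snd t then w else s # t # w)"

definition reduce :: "'i wd \<Rightarrow> 'i wd" where
  "reduce w = foldr push_letter w []"

text \<open>The free group on \<open>A\<close>, realised on the reduced words; thus \<open>\<F>\<^sub>r\<close> is \<open>free_group {..<r}\<close>.\<close>

definition free_group :: "'i set \<Rightarrow> 'i wd monoid" where
  "free_group A = \<lparr>carrier = {w \<in> words A. reduced w}, monoid.mult = (\<lambda>u v. reduce (u @ v)), one = []\<rparr>"

text \<open>The element of \<open>G\<close> obtained from a word in the indices of the list \<open>gs\<close> by the substitution
  \<open>x\<^sub>i \<mapsto> gs ! i\<close>. On \<open>free_group {..<length gs}\<close> this is the homomorphism into \<open>G\<close> with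
  \<open>x\<^sub>i \<mapsto> gs ! i\<close>.\<close>

definition word_eval :: "('g, 'm) monoid_scheme \<Rightarrow> 'g list \<Rightarrow> nat wd \<Rightarrow> 'g" where
  "word_eval G gs w =
     foldr (\<lambda>(i, b) a. (if b then gs ! i else inv\<^bsub>G\<^esub> (gs ! i)) \<otimes>\<^bsub>G\<^esub> a) w \<one>\<^bsub>G\<^esub>"


section \<open>Presentations and coherence\<close>

definition normal_closure :: "('g, 'm) monoid_scheme \<Rightarrow> 'g set \<Rightarrow> 'g set" where
  "normal_closure G S = \<Inter> {N. N \<lhd> G \<and> S \<subseteq> N}"

text \<open>\<open>\<langle>x\<^sub>0, \<dots>, x\<^sub>r\<^sub>-\<^sub>1 | R\<rangle>\<close> is a finite presentation of \<open>G\<close> on the generators \<open>gs\<close> (of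
  length \<open>r\<close>). Generators are given as a list since distinct \<open>x\<^sub>i\<close> may have the same image.\<close>

definition is_presentation :: "('g, 'm) monoid_scheme \<Rightarrow> 'g list \<Rightarrow> nat wd set \<Rightarrow> bool" where
  "is_presentation G gs R \<longleftrightarrow>
     set gs \<subseteq> carrier G \<and> generate G (set gs) = carrier G \<and>
     finite R \<and> R \<subseteq> carrier (free_group {..<length gs}) \<and>
     kernel (free_group {..<length gs}) G (word_eval G gs) =
       normal_closure (free_group {..<length gs}) R"

definition finitely_presented :: "('g, 'm) monoid_scheme \<Rightarrow> bool" where
  "finitely_presented G \<longleftrightarrow> (\<exists>gs R. is_presentation G gs R)"

definition fg_subgroup :: "'g set \<Rightarrow> ('g, 'm) monoid_scheme \<Rightarrow> bool" where
  "fg_subgroup H G \<longleftrightarrow> (\<exists>S. finite S \<and> S \<subseteq> carrier G \<and> H = generate G S)"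

definition coherent :: "('g, 'm) monoid_scheme \<Rightarrow> bool" where
  "coherent G \<longleftrightarrow>
     finitely_presented G \<and> (\<forall>H. fg_subgroup H G \<longrightarrow> finitely_presented (G\<lparr>carrier := H\<rparr>))"


section \<open>Free products and equations\<close>

text \<open>Multiplication of a normal form by a nontrivial syllable from the left.\<close>

fun push_syllable ::
  "('g, 'm) monoid_scheme \<Rightarrow> ('h, 'n) monoid_scheme \<Rightarrow> 'g + 'h \<Rightarrow> ('g + 'h) list \<Rightarrow> ('g + 'h) list"
where
  "push_syllable G H (Inl a) (Inl b # w) =
     (if a \<otimes>\<^bsub>G\<^esub> b = \<one>\<^bsub>G\<^esub> then w else Inl (a \<otimes>\<^bsub>G\<^esub> b) # w)"
| "push_syllable G H (Inr a) (Inr b # w) =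
     (if a \<otimes>\<^bsub>H\<^esub> b = \<one>\<^bsub>H\<^esub> then w else Inr (a \<otimes>\<^bsub>H\<^esub> b) # w)"
| "push_syllable G H s w = s # w"

text \<open>The free product, realised on normal forms: alternating lists of nontrivial elements of the
  two factors.\<close>

definition free_product ::
  "('g, 'm) monoid_scheme \<Rightarrow> ('h, 'n) monoid_scheme \<Rightarrow> ('g + 'h) list monoid"
where
  "free_product G H =
     \<lparr>carrier = {w. set w \<subseteq> Inl ` (carrier G - {\<one>\<^bsub>G\<^esub>}) \<union> Inr ` (carrier H - {\<one>\<^bsub>H\<^esub>}) \<and>
                   successively (\<lambda>s t. isl s \<noteq> isl t) w},
      monoid.mult = (\<lambda>u v. foldr (push_syllable G H) u v),
      one = []\<rparr>"

text \<open>\<open>H * \<langle>x\<rangle>\<close>, where the syllable \<open>Inr k\<close> stands for \<open>x\<^sup>k\<close>.\<close>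

definition eqn_group :: "('g, 'm) monoid_scheme \<Rightarrow> 'g set \<Rightarrow> ('g + int) list monoid" where
  "eqn_group G H = free_product (G\<lparr>carrier := H\<rparr>) integer_group"

definition eqn_const :: "('g, 'm) monoid_scheme \<Rightarrow> 'g \<Rightarrow> ('g + int) list" where
  "eqn_const G h = (if h = \<one>\<^bsub>G\<^esub> then [] else [Inl h])"

definition eqn_var :: "('g + int) list" where
  "eqn_var = [Inr 1]"

text \<open>The value \<open>w(g)\<close> of an equation \<open>w(x)\<close>.\<close>

definition eqn_eval :: "('g, 'm) monoid_scheme \<Rightarrow> 'g \<Rightarrow> ('g + int) list \<Rightarrow> 'g" where
  "eqn_eval G g w =
     foldr (\<lambda>s a. (case s of Inl h \<Rightarrow> h | Inr k \<Rightarrow> g [^]\<^bsub>G\<^esub> k) \<otimes>\<^bsub>G\<^esub> a) w \<one>\<^bsub>G\<^esub>"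

definition eqn_ideal :: "('g, 'm) monoid_scheme \<Rightarrow> 'g set \<Rightarrow> 'g \<Rightarrow> ('g + int) list set" where
  "eqn_ideal G H g = {w \<in> carrier (eqn_group G H). eqn_eval G g w = \<one>\<^bsub>G\<^esub>}"

definition eq_coherent :: "('g, 'm) monoid_scheme \<Rightarrow> bool" where
  "eq_coherent G \<longleftrightarrow>
     finitely_presented G \<and>
     (\<forall>H g. fg_subgroup H G \<longrightarrow> g \<in> carrier G \<longrightarrow>
        (\<exists>W. finite W \<and> W \<subseteq> carrier (eqn_group G H) \<and>
             eqn_ideal G H g = normal_closure (eqn_group G H) W))"


section \<open>Algorithms\<close>

text \<open>Programs for Kleene's partial recursive functions. \<open>computes p xs y\<close> means that \<open>p\<close>
  halts on \<open>xs\<close> with result \<open>y\<close>.\<close>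

datatype prog =
  Zero | Succ | Proj nat | Comp prog "prog list" | PrimRec prog prog | Mu prog

inductive computes :: "prog \<Rightarrow> nat list \<Rightarrow> nat \<Rightarrow> bool" where
  "computes Zero xs 0"
| "computes Succ [x] (Suc x)"
| "i < length xs \<Longrightarrow> computes (Proj i) xs (xs ! i)"
| "list_all2 (\<lambda>q y. computes q xs y) qs ys \<Longrightarrow> computes p ys z \<Longrightarrow> computes (Comp p qs) xs z"
| "computes p xs y \<Longrightarrow> computes (PrimRec p q) (0 # xs) y"
| "computes (PrimRec p q) (n # xs) y \<Longrightarrow> computes q (n # y # xs) z \<Longrightarrow>
     computes (PrimRec p q) (Suc n # xs) z"
| "computes p (n # xs) 0 \<Longrightarrow> (\<forall>m<n. \<exists>y. computes p (m # xs) (Suc y)) \<Longrightarrow> computes (Mu p) xs n"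

lemma computes_functional: "computes p xs y \<Longrightarrow> computes p xs z \<Longrightarrow> y = z"
proof (induction p xs y arbitrary: z rule: computes.induct)
  case (4 xs qs ys p z')
  from \<open>computes (Comp p qs) xs z\<close> obtain ys' where
    *: "list_all2 (\<lambda>q y. computes q xs y) qs ys'" "computes p ys' z" by cases
  have "ys = ys'"
    using 4(1) *(1) by (auto simp: list_all2_conv_all_nth intro!: nth_equalityI)
  with 4 * show ?case by blast
next
  case (7 p n xs)
  from 7(4) obtain "computes p (z # xs) 0" "\<forall>m<z. \<exists>y. computes p (m # xs) (Suc y)" by cases
  with 7 show ?case by (metis linorder_neqE_nat nat.distinct(1))
next
  case (6 p q n xs y z')
  from 6(5) obtain y' where "computes (PrimRec p q) (n # xs) y'" "computes q (n # y' # xs) z" by cases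
  with 6 show ?case by blast
next
  case 1 thus ?case by cases auto
next
  case 2 thus ?case by cases auto
next
  case 3 from 3(2) show ?case by cases auto
next
  case (5 p xs y q) from 5(3) show ?case by cases (use 5 in auto)
qed

definition encode_letter :: "nat \<times> bool \<Rightarrow> nat" where
  "encode_letter s = 2 * fst s + of_bool (snd s)"

definition encode_word :: "nat wd \<Rightarrow> nat" where
  "encode_word w = list_encode (map encode_letter w)"

definition encode_words :: "nat wd list \<Rightarrow> nat" where
  "encode_words ws = list_encode (map encode_word ws)"


section \<open>Effective coherence\<close>

text \<open>Here \<open>as\<close> is the list of generators of the ambient presentation of \<open>G\<close>. Inputs and outputs
  are arbitrary words, not necessarily reduced. The program \<open>p\<close> need only halt on (codes of) lists
  of words on the given generators.\<close>

definition effectively_coherent :: "('g, 'm) monoid_scheme \<Rightarrow> 'g list \<Rightarrow> bool" where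
  "effectively_coherent G as \<longleftrightarrow>
     coherent G \<and>
     (\<exists>p. \<forall>us. set us \<subseteq> words {..<length as} \<longrightarrow>
        (\<exists>ws. computes p [encode_words us] (encode_words ws) \<and>
              set ws \<subseteq> words {..<length us} \<and>
              (let hs = map (word_eval G as) us
               in is_presentation (G\<lparr>carrier := generate G (set hs)\<rparr>) hs (reduce ` set ws))))"

text \<open>The group \<open>H * \<langle>x\<rangle>\<close> is generated by \<open>h\<^sub>0, \<dots>, h\<^sub>r\<^sub>-\<^sub>1, x\<close>; the algorithm outputs its elements as
  words in these generators, i.e. as words over \<open>{..<Suc r}\<close> whose letter \<open>r\<close> stands for \<open>x\<close>.\<close>

definition effectively_eq_coherent :: "('g, 'm) monoid_scheme \<Rightarrow> 'g list \<Rightarrow> bool" where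
  "effectively_eq_coherent G as \<longleftrightarrow>
     eq_coherent G \<and>
     (\<exists>p. \<forall>us v. set us \<subseteq> words {..<length as} \<longrightarrow> v \<in> words {..<length as} \<longrightarrow>
        (\<exists>ws. computes p [encode_words us, encode_word v] (encode_words ws) \<and>
              set ws \<subseteq> words {..<Suc (length us)} \<and>
              (let hs = map (word_eval G as) us;
                   H = generate G (set hs);
                   W = word_eval (eqn_group G H) (map (eqn_const G) hs @ [eqn_var]) ` set ws
               in eqn_ideal G H (word_eval G as v) = normal_closure (eqn_group G H) W)))"

end

theory Submission
  imports Defs
begin

text \<open>
  Let \<open>H = \<langle>h\<^sub>0, \<dots>, h\<^sub>r\<^sub>-\<^sub>1\<rangle>\<close> and \<open>g \<in> G\<close>. The epimorphism \<open>\<psi> : \<F>\<^sub>r\<^sub>+\<^sub>1 \<rightarrow> H * \<langle>x\<rangle>\<close> with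
  \<open>x\<^sub>i \<mapsto> h\<^sub>i\<close> for \<open>i < r\<close> and \<open>x\<^sub>r \<mapsto> x\<close>, followed by the substitution \<open>x \<mapsto> g\<close>, is the canonical map
  \<open>\<phi> : \<F>\<^sub>r\<^sub>+\<^sub>1 \<rightarrow> \<langle>H, g\<rangle>\<close>. Therefore \<open>ker \<phi>\<close> is the preimage of \<open>I\<^sub>H(g)\<close> under \<open>\<psi>\<close>, and
  \<open>I\<^sub>H(g) = \<psi>(ker \<phi>)\<close>: generating the ideal and presenting \<open>\<langle>H, g\<rangle>\<close> are almost the same task.

  From presentations to ideals (\<open>eqn_ideal_of_presentation\<close>): the images under \<open>\<psi>\<close> of defining
  relators of \<open>\<langle>H, g\<rangle>\<close> on \<open>h\<^sub>0, \<dots>, h\<^sub>r\<^sub>-\<^sub>1, g\<close> generate \<open>I\<^sub>H(g)\<close>. Coherence only promises finitely many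
  relators on some generators, but finiteness of the relators passes to every finite list of
  generators (\<open>is_presentation_change_gens\<close>).

  From ideals to presentations (\<open>presentation_of_eqn_ideal\<close>): lifts of generators of \<open>I\<^sub>H(g)\<close>
  together with generators of \<open>ker \<psi>\<close> generate \<open>ker \<phi>\<close>, and \<open>ker \<psi>\<close> is generated by relators of
  \<open>H\<close> (\<open>to_eqn_kernel\<close>). So a presentation of \<open>H\<close> extends to one of \<open>\<langle>H, g\<rangle>\<close>, and induction on the
  number of generators, starting from the trivial group, presents every finitely generated
  subgroup.

  Both passages are effective. The first one feeds \<open>h\<^sub>0, \<dots>, h\<^sub>r\<^sub>-\<^sub>1, g\<close> to the presentation algorithm
  and keeps its output. The second one runs the ideal algorithm on \<open>h\<^sub>0, \<dots>, h\<^sub>i\<^sub>-\<^sub>1; h\<^sub>i\<close> for all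
  \<open>i < r\<close> and concatenates the outputs. Words are handled as opaque codes throughout, so the only
  programming needed concerns lists of numbers: appending one entry (\<open>computes_snoc\<close>) and looping
  over the prefixes of a list (\<open>computes_scan\<close>).
\<close>

section \<open>Normal closures and homomorphisms\<close>

lemma normal_closure_normal:
  assumes "group G" "S \<subseteq> carrier G"
  shows "normal_closure G S \<lhd> G"
proof -
  interpret group G by fact
  let ?NN = "{N. N \<lhd> G \<and> S \<subseteq> N}"
  have "carrier G \<in> ?NN"
    using assms normal_inv_iff[of "carrier G"] subgroup_self by auto
  hence "?NN \<noteq> {}" by blast
  moreover have "subgroup N G" if "N \<in> ?NN" for N
    using that normal_imp_subgroup by blast
  ultimately have "subgroup (\<Inter>?NN) G" by (rule subgroups_Inter[rotated])
  moreover have "x \<otimes>\<^bsub>G\<^esub> h \<otimes>\<^bsub>G\<^esub> inv\<^bsub>G\<^esub> x \<in> \<Inter>?NN" if "x \<in> carrier G" "h \<in> \<Inter>?NN" for x h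
    using that normal.inv_op_closed2 by fastforce
  ultimately show ?thesis unfolding normal_closure_def normal_inv_iff by blast
qed

lemma normal_closure_incl: "S \<subseteq> normal_closure G S"
  unfolding normal_closure_def by blast

lemma normal_closure_minimal: "N \<lhd> G \<Longrightarrow> S \<subseteq> N \<Longrightarrow> normal_closure G S \<subseteq> N"
  unfolding normal_closure_def by blast

lemma normal_vimage:
  assumes "group A" "group B" "f \<in> hom A B" "N \<lhd> B"
  shows "{x \<in> carrier A. f x \<in> N} \<lhd> A"
proof -
  interpret group_hom A B f
    using assms by (simp add: group_hom_def group_hom_axioms_def)
  interpret N: normal N B by fact
  have "subgroup {x \<in> carrier A. f x \<in> N} A"
    by (rule G.subgroupI) (auto intro: exI[of _ "\<one>\<^bsub>A\<^esub>"])
  thus ?thesis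
    unfolding G.normal_inv_iff using N.inv_op_closed2 by auto
qed

lemma normal_image:
  assumes "group A" "group B" "f \<in> hom A B" "f ` carrier A = carrier B" "N \<lhd> A"
  shows "f ` N \<lhd> B"
proof -
  interpret group_hom A B f
    using assms by (simp add: group_hom_def group_hom_axioms_def)
  interpret N: normal N A by fact
  have "subgroup (f ` N) B"
    by (rule subgroup_img_is_subgroup) (rule N.subgroup_axioms)
  moreover have "x \<otimes>\<^bsub>B\<^esub> h \<otimes>\<^bsub>B\<^esub> inv\<^bsub>B\<^esub> x \<in> f ` N" if "x \<in> carrier B" "h \<in> f ` N" for x h
  proof -
    obtain y n where y: "y \<in> carrier A" "x = f y" and n: "n \<in> N" "h = f n"
      using \<open>x \<in> carrier B\<close> \<open>h \<in> f ` N\<close> assms(4) by blast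
    have "x \<otimes>\<^bsub>B\<^esub> h \<otimes>\<^bsub>B\<^esub> inv\<^bsub>B\<^esub> x = f (y \<otimes>\<^bsub>A\<^esub> n \<otimes>\<^bsub>A\<^esub> inv\<^bsub>A\<^esub> y)"
      using y n N.subset by auto
    thus ?thesis using N.inv_op_closed2[OF y(1) n(1)] by blast
  qed
  ultimately show ?thesis unfolding H.normal_inv_iff by blast
qed

text \<open>The preimage of a normal subgroup is normal, so it contains the normal closure of every subset.\<close>

lemma image_normal_closure_subset:
  assumes "group A" "group B" "f \<in> hom A B" "S \<subseteq> carrier A" "N \<lhd> B" "f ` S \<subseteq> N"
  shows "f ` normal_closure A S \<subseteq> N"
  using normal_closure_minimal[OF normal_vimage[OF assms(1,2,3,5)], of S] assms(4,6) by blast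

lemma image_normal_closure:
  assumes "group A" "group B" "f \<in> hom A B" "f ` carrier A = carrier B" "S \<subseteq> carrier A"
  shows "f ` normal_closure A S = normal_closure B (f ` S)"
proof
  have "f ` S \<subseteq> carrier B" using assms(4,5) by blast
  thus "f ` normal_closure A S \<subseteq> normal_closure B (f ` S)"
    by (rule image_normal_closure_subset[OF assms(1-3,5) normal_closure_normal[OF assms(2)]
          normal_closure_incl])
  have "f ` normal_closure A S \<lhd> B"
    using assms by (intro normal_image[of A] normal_closure_normal)
  thus "normal_closure B (f ` S) \<subseteq> f ` normal_closure A S"
    by (rule normal_closure_minimal) (intro image_mono normal_closure_incl)
qed

text \<open>An element of the preimage agrees, up to the kernel, with an element of the normal closure of
  \<open>S\<close>; hence the preimage is generated by \<open>S\<close> and generators of the kernel.\<close>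

lemma vimage_normal_closure:
  assumes "group A" "group B" "f \<in> hom A B" "f ` carrier A = carrier B" "S \<subseteq> carrier A"
    and "R \<subseteq> carrier A" "kernel A B f = normal_closure A R"
  shows "{x \<in> carrier A. f x \<in> normal_closure B (f ` S)} = normal_closure A (R \<union> S)"
proof
  interpret group_hom A B f
    using assms by (simp add: group_hom_def group_hom_axioms_def)
  let ?N = "normal_closure A (R \<union> S)"
  have N: "?N \<lhd> A" using assms(5,6) by (intro normal_closure_normal[OF assms(1)]) auto
  interpret N: normal ?N A by fact
  have incl: "R \<subseteq> ?N" "S \<subseteq> ?N" using normal_closure_incl[of "R \<union> S" A] by auto
  have ker: "kernel A B f \<subseteq> ?N"
    unfolding assms(7) by (rule normal_closure_minimal[OF N incl(1)])
  show "{x \<in> carrier A. f x \<in> normal_closure B (f ` S)} \<subseteq> ?N"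
  proof safe
    fix x assume x: "x \<in> carrier A" "f x \<in> normal_closure B (f ` S)"
    then obtain y where y: "y \<in> normal_closure A S" "f x = f y"
      using image_normal_closure[OF assms(1-5)] by blast
    have "y \<in> ?N" using y(1) normal_closure_minimal[OF N incl(2)] by blast
    moreover from this have yc: "y \<in> carrier A" by (rule N.mem_carrier)
    have "x \<otimes>\<^bsub>A\<^esub> inv\<^bsub>A\<^esub> y \<in> kernel A B f"
      using x yc y(2) by (simp add: kernel_def)
    ultimately have "(x \<otimes>\<^bsub>A\<^esub> inv\<^bsub>A\<^esub> y) \<otimes>\<^bsub>A\<^esub> y \<in> ?N" using ker by blast
    thus "x \<in> ?N" using x yc by (simp add: G.m_assoc)
  qed
  have fS: "f ` S \<subseteq> carrier B" using assms(4,5) by blast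
  have M: "normal_closure B (f ` S) \<lhd> B" by (rule normal_closure_normal[OF assms(2) fS])
  then interpret M: normal "normal_closure B (f ` S)" B .
  have "R \<subseteq> kernel A B f" using normal_closure_incl[of R A] assms(7) by simp
  hence "f ` (R \<union> S) \<subseteq> normal_closure B (f ` S)"
    using normal_closure_incl[of "f ` S" B] M.one_closed by (auto simp: kernel_def subset_eq)
  hence "R \<union> S \<subseteq> {x \<in> carrier A. f x \<in> normal_closure B (f ` S)}"
    using assms(5,6) by auto
  thus "?N \<subseteq> {x \<in> carrier A. f x \<in> normal_closure B (f ` S)}"
    by (rule normal_closure_minimal[OF normal_vimage[OF assms(1-3) M]])
qed


section \<open>Free groups\<close>

lemma words_simps [simp]:
  "[] \<in> words A"
  "(s # w \<in> words A) = (fst s \<in> A \<and> w \<in> words A)"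
  "(u @ v \<in> words A) = (u \<in> words A \<and> v \<in> words A)"
  by (auto simp: words_def)

lemma reduced_simps [simp]:
  "reduced []"
  "reduced [s]"
  "reduced (s # t # w) = (\<not> (fst s = fst t \<and> snd s \<noteq> snd t) \<and> reduced (t # w))"
  by (auto simp: reduced_def)

lemma reduced_ConsD: "reduced (s # w) \<Longrightarrow> reduced w"
  by (cases w) auto

lemma reduce_simps [simp]: "reduce [] = []" "reduce (s # w) = push_letter s (reduce w)"
  by (auto simp: reduce_def)

lemma push_letter_reduced: "reduced w \<Longrightarrow> reduced (push_letter s w)"
  by (cases w) (auto dest: reduced_ConsD)

lemma push_letter_eq_Cons: "reduced (s # w) \<Longrightarrow> push_letter s w = s # w"
  by (cases w) auto

lemma push_letter_words: "fst s \<in> A \<Longrightarrow> w \<in> words A \<Longrightarrow> push_letter s w \<in> words A"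
  by (cases w) auto

lemma push_letter_cancel:
  assumes "reduced w" "fst s = fst t" "snd s \<noteq> snd t"
  shows "push_letter s (push_letter t w) = w"
proof (cases w)
  case (Cons r v)
  thus ?thesis using assms by (cases v) (auto simp: prod_eq_iff)
qed (use assms in auto)

lemma reduced_reduce: "reduced (reduce w)"
  by (induction w) (auto intro: push_letter_reduced)

lemma reduce_reduced: "reduced w \<Longrightarrow> reduce w = w"
proof (induction w)
  case (Cons s w)
  thus ?case using reduced_ConsD[OF Cons.prems] push_letter_eq_Cons[OF Cons.prems] by simp
qed simp

lemma reduce_words: "w \<in> words A \<Longrightarrow> reduce w \<in> words A"
  by (induction w) (auto intro: push_letter_words)

text \<open>Pushing a letter and then its inverse onto a reduced word changes nothing. Hence reduction may
  be carried out in any part of a product first, which is associativity of the multiplication.\<close>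

lemma reduce_push_letter_append: "reduce (push_letter s u @ v) = push_letter s (reduce (u @ v))"
  by (cases u) (auto simp: push_letter_cancel reduced_reduce)

lemma reduce_append_left: "reduce (reduce u @ v) = reduce (u @ v)"
  by (induction u) (auto simp: reduce_push_letter_append)

lemma reduce_append_right: "reduce (u @ reduce v) = reduce (u @ v)"
  by (induction u) (auto simp: reduce_reduced reduced_reduce)

lemma free_group_simps:
  "carrier (free_group A) = {w \<in> words A. reduced w}"
  "u \<otimes>\<^bsub>free_group A\<^esub> v = reduce (u @ v)"
  "\<one>\<^bsub>free_group A\<^esub> = []"
  by (auto simp: free_group_def)

lemma reduce_inverse_word: "reduce (rev (map (\<lambda>(i, b). (i, \<not> b)) w) @ w) = []"
proof (induction w)
  case (Cons s w)
  have "reduce (rev (map (\<lambda>(i, b). (i, \<not> b)) (s # w)) @ s # w)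
      = reduce (rev (map (\<lambda>(i, b). (i, \<not> b)) w) @
          reduce ((\<lambda>(i, b). (i, \<not> b)) s # s # w))"
    by (simp only: reduce_append_right) simp
  also have "reduce ((\<lambda>(i, b). (i, \<not> b)) s # s # w) = reduce w"
    by (auto simp: push_letter_cancel reduced_reduce case_prod_beta)
  finally show ?case using Cons by (simp add: reduce_append_right)
qed auto

lemma group_free_group: "group (free_group A)"
proof (rule groupI)
  fix w assume w: "w \<in> carrier (free_group A)"
  let ?v = "rev (map (\<lambda>(i, b). (i, \<not> b)) w)"
  have "?v \<in> words A" using w by (auto simp: free_group_simps words_def)
  hence "reduce ?v \<in> carrier (free_group A)"
    by (auto simp: free_group_simps reduced_reduce reduce_words)
  moreover have "reduce ?v \<otimes>\<^bsub>free_group A\<^esub> w = \<one>\<^bsub>free_group A\<^esub>"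
    by (simp add: free_group_simps reduce_append_left reduce_inverse_word)
  ultimately show "\<exists>y\<in>carrier (free_group A). y \<otimes>\<^bsub>free_group A\<^esub> w = \<one>\<^bsub>free_group A\<^esub>" by blast
qed (auto simp: free_group_simps reduced_reduce reduce_words reduce_append_left
       reduce_append_right reduce_reduced)

lemma reduce_in_free_group: "w \<in> words A \<Longrightarrow> reduce w \<in> carrier (free_group A)"
  by (simp add: free_group_simps reduced_reduce reduce_words)


section \<open>Evaluation of words\<close>

lemma word_eval_simps [simp]:
  "word_eval G gs [] = \<one>\<^bsub>G\<^esub>"
  "word_eval G gs (s # w) =
     (if snd s then gs ! fst s else inv\<^bsub>G\<^esub> (gs ! fst s)) \<otimes>\<^bsub>G\<^esub> word_eval G gs w"
  by (auto simp: word_eval_def case_prod_beta)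

lemma (in group) word_eval_closed:
  "set gs \<subseteq> carrier G \<Longrightarrow> w \<in> words {..<length gs} \<Longrightarrow> word_eval G gs w \<in> carrier G"
  by (induction w) (auto simp: subset_eq)

lemma (in group) word_eval_append:
  assumes "set gs \<subseteq> carrier G" "u \<in> words {..<length gs}" "v \<in> words {..<length gs}"
  shows "word_eval G gs (u @ v) = word_eval G gs u \<otimes> word_eval G gs v"
  using assms(2)
  by (induction u) (use assms in \<open>auto simp: word_eval_closed m_assoc subset_eq\<close>)

lemma (in group) word_eval_push_letter:
  assumes "set gs \<subseteq> carrier G" "s # w \<in> words {..<length gs}"
  shows "word_eval G gs (push_letter s w) = word_eval G gs (s # w)"
proof (cases w)
  case (Cons t v)
  have [simp]: "word_eval G gs v \<in> carrier G" "gs ! fst t \<in> carrier G"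
    using assms Cons by (auto simp: word_eval_closed subset_eq)
  show ?thesis using Cons by (auto simp: m_assoc[symmetric])
qed auto

lemma (in group) word_eval_reduce:
  assumes "set gs \<subseteq> carrier G" "w \<in> words {..<length gs}"
  shows "word_eval G gs (reduce w) = word_eval G gs w"
  using assms(2) by (induction w) (use assms(1) in \<open>auto simp: word_eval_push_letter reduce_words\<close>)

lemma (in group) word_eval_hom:
  "set gs \<subseteq> carrier G \<Longrightarrow> word_eval G gs \<in> hom (free_group {..<length gs}) G"
  by (auto simp: hom_def free_group_simps word_eval_closed word_eval_reduce word_eval_append)

lemma hom_word_eval:
  assumes "group G" "group K" "f \<in> hom G K" "set gs \<subseteq> carrier G" "w \<in> words {..<length gs}"
  shows "f (word_eval G gs w) = word_eval K (map f gs) w"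
proof -
  interpret group_hom G K f
    using assms by (simp add: group_hom_def group_hom_axioms_def)
  show ?thesis using assms(5)
    by (induction w) (use assms(4) in \<open>auto simp: G.word_eval_closed subset_eq\<close>)
qed

lemma word_eval_append_gens:
  "w \<in> words {..<length gs} \<Longrightarrow> word_eval G (gs @ gs') w = word_eval G gs w"
  by (induction w) (auto simp: nth_append)

lemma word_eval_subgroup:
  assumes "group G" "subgroup H G" "set gs \<subseteq> H" "w \<in> words {..<length gs}"
  shows "word_eval (G\<lparr>carrier := H\<rparr>) gs w = word_eval G gs w"
  using assms(4)
  by (induction w) (use assms in \<open>auto simp: group.m_inv_consistent subset_eq\<close>)

lemma (in group) word_eval_image:
  assumes "set gs \<subseteq> carrier G"
  shows "word_eval G gs ` carrier (free_group {..<length gs}) = generate G (set gs)"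
proof
  have "word_eval G gs w \<in> generate G (set gs)" if "w \<in> words {..<length gs}" for w
    using that by (induction w) (auto intro: generate.incl generate.inv generate.one intro!: generate.eng)
  thus "word_eval G gs ` carrier (free_group {..<length gs}) \<subseteq> generate G (set gs)"
    by (auto simp: free_group_simps)
  interpret h: group_hom "free_group {..<length gs}" G "word_eval G gs"
    using word_eval_hom[OF assms] group_free_group
    by (simp add: group_hom_def group_hom_axioms_def)
  show "generate G (set gs) \<subseteq> word_eval G gs ` carrier (free_group {..<length gs})"
  proof (rule generate_subgroup_incl[OF _ h.img_is_subgroup], safe)
    fix x assume "x \<in> set gs"
    then obtain i where "i < length gs" "x = gs ! i" by (auto simp: in_set_conv_nth)
    hence "x = word_eval G gs [(i, True)]" "[(i, True)] \<in> carrier (free_group {..<length gs})"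
      using assms by (auto simp: free_group_simps subset_eq)
    thus "x \<in> word_eval G gs ` carrier (free_group {..<length gs})" by blast
  qed
qed

abbreviation free_gens :: "nat \<Rightarrow> nat wd list" where
  "free_gens n \<equiv> map (\<lambda>i. [(i, True)]) [0..<n]"

lemma free_gens_carrier: "set (free_gens n) \<subseteq> carrier (free_group {..<n})"
  by (auto simp: free_group_simps)

lemma word_eval_free_gens:
  assumes "w \<in> words {..<n}"
  shows "word_eval (free_group {..<n}) (free_gens n) w = reduce w"
  using assms
proof (induction w)
  case (Cons s w)
  interpret group "free_group {..<n}" by (rule group_free_group)
  have "inv\<^bsub>free_group {..<n}\<^esub> [(fst s, True)] = [(fst s, False)]"
    using Cons.prems by (intro inv_equality) (auto simp: free_group_simps)
  thus ?case using Cons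
    by (cases s) (auto simp: free_group_simps reduce_reduced reduced_reduce)
qed (simp add: free_group_simps)

text \<open>A homomorphism on a free group is determined by its values on the free generators.\<close>

lemma hom_free_group_eq_word_eval:
  assumes "group K" "f \<in> hom (free_group {..<n}) K" "w \<in> carrier (free_group {..<n})"
  shows "f w = word_eval K (map (\<lambda>i. f [(i, True)]) [0..<n]) w"
proof -
  have "f (word_eval (free_group {..<n}) (free_gens n) w) = word_eval K (map f (free_gens n)) w"
    using assms by (intro hom_word_eval group_free_group free_gens_carrier)
      (auto simp: free_group_simps)
  thus ?thesis using assms(3)
    by (simp add: word_eval_free_gens free_group_simps reduce_reduced comp_def)
qed


section \<open>Presentations on prescribed generators\<close>

lemma r_coset_eq_normal:
  assumes "N \<lhd> G" "x \<in> carrier G"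
  shows "N #>\<^bsub>G\<^esub> x = N \<longleftrightarrow> x \<in> N"
proof -
  interpret normal N G by fact
  show ?thesis using assms(2) coset_join1 coset_join2 subgroup_axioms subset by blast
qed

text \<open>Finite presentability does not depend on the choice of finitely many generators. Let
  \<open>G = \<langle>y\<^sub>j | S\<rangle>\<close> and express the generators in each other: \<open>y\<^sub>j = v\<^sub>j(h)\<close> and \<open>h\<^sub>i = u\<^sub>i(y)\<close>. With
  \<open>\<alpha> : y\<^sub>j \<mapsto> v\<^sub>j\<close> and \<open>\<beta> : x\<^sub>i \<mapsto> u\<^sub>i\<close>, the relators \<open>\<alpha>(s)\<close> for \<open>s \<in> S\<close> and
  \<open>x\<^sub>i \<alpha>(\<beta>(x\<^sub>i))\<^sup>-\<^sup>1\<close> suffice on the generators \<open>h\<close>: modulo them \<open>w = \<alpha>(\<beta>(w))\<close> for every word \<open>w\<close>, and if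
  \<open>w\<close> is trivial in \<open>G\<close> then so is \<open>\<beta>(w)\<close>, which therefore follows from \<open>S\<close>.\<close>

lemma is_presentation_change_gens:
  assumes "group G" "is_presentation G ys S" "set hs \<subseteq> carrier G"
    "generate G (set hs) = carrier G"
  shows "\<exists>T. is_presentation G hs T"
proof -
  interpret group G by fact
  let ?m = "length ys" and ?n = "length hs"
  let ?Fm = "free_group {..<?m}" and ?Fn = "free_group {..<?n}"
  interpret Fm: group ?Fm by (rule group_free_group)
  interpret Fn: group ?Fn by (rule group_free_group)
  note S = assms(2)[unfolded is_presentation_def]
  have "set ys \<subseteq> word_eval G hs ` carrier ?Fn"
    using word_eval_image[OF assms(3)] assms(4) S by simp
  hence "\<forall>y\<in>set ys. \<exists>v. v \<in> carrier ?Fn \<and> word_eval G hs v = y" by blast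
  then obtain v where v: "\<And>y. y \<in> set ys \<Longrightarrow> v y \<in> carrier ?Fn \<and> word_eval G hs (v y) = y"
    by metis
  have "set hs \<subseteq> word_eval G ys ` carrier ?Fm"
    using word_eval_image[of ys] assms(3) S by simp
  hence "\<forall>h\<in>set hs. \<exists>u. u \<in> carrier ?Fm \<and> word_eval G ys u = h" by blast
  then obtain u where u: "\<And>h. h \<in> set hs \<Longrightarrow> u h \<in> carrier ?Fm \<and> word_eval G ys (u h) = h"
    by metis
  define \<alpha> where "\<alpha> = word_eval ?Fn (map v ys)"
  define \<beta> where "\<beta> = word_eval ?Fm (map u hs)"
  have vs: "set (map v ys) \<subseteq> carrier ?Fn" using v by auto
  have us: "set (map u hs) \<subseteq> carrier ?Fm" using u by auto
  have \<alpha>: "\<alpha> \<in> hom ?Fm ?Fn" using Fn.word_eval_hom[OF vs] by (simp add: \<alpha>_def)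
  have \<beta>: "\<beta> \<in> hom ?Fn ?Fm" using Fm.word_eval_hom[OF us] by (simp add: \<beta>_def)
  have \<alpha>c: "\<alpha> w \<in> carrier ?Fn" if "w \<in> carrier ?Fm" for w
    using \<alpha> that by (auto simp: hom_def)
  have \<beta>c: "\<beta> w \<in> carrier ?Fm" if "w \<in> carrier ?Fn" for w
    using \<beta> that by (auto simp: hom_def)
  have hsh: "word_eval G hs \<in> hom ?Fn G" by (rule word_eval_hom[OF assms(3)])
  have ysh: "word_eval G ys \<in> hom ?Fm G" using S by (intro word_eval_hom) auto
  have \<alpha>_eval: "word_eval G hs (\<alpha> w) = word_eval G ys w" if "w \<in> carrier ?Fm" for w
  proof -
    have "map (word_eval G hs) (map v ys) = ys" using v by (auto intro: map_idI)
    thus ?thesis unfolding \<alpha>_def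
      using hom_word_eval[OF Fn.group_axioms assms(1) hsh vs, of w] that
      by (simp add: free_group_simps)
  qed
  have \<beta>_eval: "word_eval G ys (\<beta> w) = word_eval G hs w" if "w \<in> carrier ?Fn" for w
  proof -
    have "map (word_eval G ys) (map u hs) = hs" using u by (auto intro: map_idI)
    thus ?thesis unfolding \<beta>_def
      using hom_word_eval[OF Fm.group_axioms assms(1) ysh us, of w] that
      by (simp add: free_group_simps)
  qed
  define x where "x = (\<lambda>i::nat. [(i, True)])"
  have xc: "x i \<in> carrier ?Fn" if "i < ?n" for i
    using that by (simp add: x_def free_group_simps)
  have x_eval: "word_eval G hs (x i) = hs ! i" if "i < ?n" for i
    using that assms(3) by (simp add: x_def subset_eq)
  have \<beta>x: "\<beta> (x i) = u (hs ! i)" if "i < ?n" for i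
    using that us by (simp add: x_def \<beta>_def subset_eq)
  define T where "T = \<alpha> ` S \<union> (\<lambda>i. x i \<otimes>\<^bsub>?Fn\<^esub> inv\<^bsub>?Fn\<^esub> \<alpha> (\<beta> (x i))) ` {..<?n}"
  have Tc: "T \<subseteq> carrier ?Fn" unfolding T_def using S by (auto intro!: \<alpha>c \<beta>c xc)
  let ?N = "normal_closure ?Fn T"
  have N: "?N \<lhd> ?Fn" by (rule normal_closure_normal[OF Fn.group_axioms Tc])
  then interpret N: normal ?N ?Fn .
  let ?Q = "?Fn Mod ?N"
  interpret Q: group ?Q by (rule N.factorgroup_is_group)
  have \<pi>: "(\<lambda>w. ?N #>\<^bsub>?Fn\<^esub> w) \<in> hom ?Fn ?Q" by (rule N.r_coset_hom_Mod)
  have \<pi>\<alpha>\<beta>: "(\<lambda>w. ?N #>\<^bsub>?Fn\<^esub> \<alpha> (\<beta> w)) \<in> hom ?Fn ?Q"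
    using Group.hom_compose[OF Group.hom_compose[OF \<beta> \<alpha>] \<pi>] by (simp add: comp_def)
  have agree: "?N #>\<^bsub>?Fn\<^esub> x i = ?N #>\<^bsub>?Fn\<^esub> \<alpha> (\<beta> (x i))" if "i < ?n" for i
  proof -
    have "x i \<otimes>\<^bsub>?Fn\<^esub> inv\<^bsub>?Fn\<^esub> \<alpha> (\<beta> (x i)) \<in> ?N"
      using that normal_closure_incl[of T ?Fn] by (auto simp: T_def)
    hence "x i \<in> ?N #>\<^bsub>?Fn\<^esub> \<alpha> (\<beta> (x i))"
      using that xc \<alpha>c \<beta>c by (intro N.rcos_module_rev) auto
    thus ?thesis
      using that xc \<alpha>c \<beta>c N.subgroup_axioms by (intro Fn.repr_independence[symmetric]) auto
  qed
  have \<pi>_eq: "?N #>\<^bsub>?Fn\<^esub> w = ?N #>\<^bsub>?Fn\<^esub> \<alpha> (\<beta> w)" if "w \<in> carrier ?Fn" for w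
  proof -
    have gens: "map (\<lambda>i. ?N #>\<^bsub>?Fn\<^esub> [(i, True)]) [0..<?n]
        = map (\<lambda>i. ?N #>\<^bsub>?Fn\<^esub> \<alpha> (\<beta> [(i, True)])) [0..<?n]"
      using agree by (simp add: x_def)
    show ?thesis
      unfolding hom_free_group_eq_word_eval[OF Q.group_axioms \<pi> that]
        hom_free_group_eq_word_eval[OF Q.group_axioms \<pi>\<alpha>\<beta> that] gens ..
  qed
  have "\<alpha> ` normal_closure ?Fm S \<subseteq> ?N"
    using S normal_closure_incl[of T ?Fn]
    by (intro image_normal_closure_subset[OF Fm.group_axioms Fn.group_axioms \<alpha> _ N])
      (auto simp: T_def)
  moreover have "w \<in> normal_closure ?Fm S"
    if "w \<in> carrier ?Fm" "word_eval G ys w = \<one>\<^bsub>G\<^esub>" for w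
    using that S unfolding kernel_def by blast
  ultimately have \<alpha>_ker: "\<alpha> w \<in> ?N"
    if "w \<in> carrier ?Fm" "word_eval G ys w = \<one>\<^bsub>G\<^esub>" for w
    using that by blast
  have "kernel ?Fn G (word_eval G hs) = ?N"
  proof
    show "kernel ?Fn G (word_eval G hs) \<subseteq> ?N"
    proof
      fix w assume "w \<in> kernel ?Fn G (word_eval G hs)"
      hence w: "w \<in> carrier ?Fn" "word_eval G hs w = \<one>\<^bsub>G\<^esub>" by (auto simp: kernel_def)
      hence "\<alpha> (\<beta> w) \<in> ?N" by (intro \<alpha>_ker \<beta>c) (auto simp: \<beta>_eval)
      hence "?N #>\<^bsub>?Fn\<^esub> w = ?N"
        using r_coset_eq_normal[OF N] \<pi>_eq w \<alpha>c \<beta>c by simp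
      thus "w \<in> ?N" using r_coset_eq_normal[OF N] w by simp
    qed
    interpret h: group_hom ?Fn G "word_eval G hs"
      using hsh by unfold_locales
    have "S \<subseteq> kernel ?Fm G (word_eval G ys)" using S normal_closure_incl[of S ?Fm] by simp
    hence "T \<subseteq> kernel ?Fn G (word_eval G hs)"
      unfolding T_def kernel_def using xc \<alpha>c \<beta>c
      by (auto simp: \<alpha>_eval \<beta>_eval h.hom_closed subset_eq)
    thus "?N \<subseteq> kernel ?Fn G (word_eval G hs)"
      by (intro normal_closure_minimal h.normal_kernel)
  qed
  moreover have "finite T" using S by (simp add: T_def)
  ultimately have "is_presentation G hs T"
    using assms(3,4) Tc by (simp add: is_presentation_def)
  thus ?thesis ..
qed


section \<open>Free products\<close>

lemma free_product_simps:
  "carrier (free_product A B) =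
     {w. set w \<subseteq> Inl ` (carrier A - {\<one>\<^bsub>A\<^esub>}) \<union> Inr ` (carrier B - {\<one>\<^bsub>B\<^esub>}) \<and>
         successively (\<lambda>s t. isl s \<noteq> isl t) w}"
  "u \<otimes>\<^bsub>free_product A B\<^esub> v = foldr (push_syllable A B) u v"
  "\<one>\<^bsub>free_product A B\<^esub> = []"
  by (auto simp: free_product_def)

definition syllables :: "('g, 'm) monoid_scheme \<Rightarrow> ('h, 'n) monoid_scheme \<Rightarrow> ('g + 'h) set" where
  "syllables A B = Inl ` (carrier A - {\<one>\<^bsub>A\<^esub>}) \<union> Inr ` (carrier B - {\<one>\<^bsub>B\<^esub>})"

lemma free_product_carrier_simps [simp]:
  "[] \<in> carrier (free_product A B)"
  "([s] \<in> carrier (free_product A B)) = (s \<in> syllables A B)"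
  "(s # t # w \<in> carrier (free_product A B)) =
     (s \<in> syllables A B \<and> isl s \<noteq> isl t \<and> t # w \<in> carrier (free_product A B))"
  by (auto simp: free_product_simps syllables_def)

lemma free_product_ConsD:
  "s # w \<in> carrier (free_product A B) \<Longrightarrow> s \<in> syllables A B \<and> w \<in> carrier (free_product A B)"
  by (cases w) auto

lemma free_product_set: "w \<in> carrier (free_product A B) \<Longrightarrow> set w \<subseteq> syllables A B"
  by (simp add: free_product_simps syllables_def)

lemma push_syllable_eq_Cons:
  "s # w \<in> carrier (free_product A B) \<Longrightarrow> push_syllable A B s w = s # w"
  by (cases w; cases s; cases "hd w") auto

definition fp_inl :: "('g, 'm) monoid_scheme \<Rightarrow> 'g \<Rightarrow> ('g + 'h) list" where
  "fp_inl A a = (if a = \<one>\<^bsub>A\<^esub> then [] else [Inl a])"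

definition fp_inr :: "('h, 'n) monoid_scheme \<Rightarrow> 'h \<Rightarrow> ('g + 'h) list" where
  "fp_inr B b = (if b = \<one>\<^bsub>B\<^esub> then [] else [Inr b])"

locale two_groups = A: group A + B: group B
  for A :: "('g, 'm) monoid_scheme" and B :: "('h, 'n) monoid_scheme"
begin

abbreviation "P \<equiv> free_product A B"
abbreviation "push \<equiv> push_syllable A B"

lemma syllables_cases [consumes 1, case_names Inl Inr]:
  assumes "s \<in> syllables A B"
  obtains a where "s = Inl a" "a \<in> carrier A" "a \<noteq> \<one>\<^bsub>A\<^esub>"
  | b where "s = Inr b" "b \<in> carrier B" "b \<noteq> \<one>\<^bsub>B\<^esub>"
  using assms by (auto simp: syllables_def)

lemma push_closed:
  assumes "s \<in> syllables A B" "w \<in> carrier P"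
  shows "push s w \<in> carrier P"
proof (cases w)
  case (Cons t v)
  hence t: "t \<in> syllables A B" and v: "v \<in> carrier P" using assms free_product_ConsD by blast+
  have "r # v \<in> carrier P" if "isl r = isl t" "r \<in> syllables A B" for r
    using that assms(2) Cons by (cases v) auto
  thus ?thesis using assms v unfolding Cons
    by (cases rule: syllables_cases[OF assms(1)]; cases rule: syllables_cases[OF t])
      (auto simp: syllables_def)
qed (use assms in \<open>cases s; auto\<close>)

lemma foldr_push_closed:
  "set u \<subseteq> syllables A B \<Longrightarrow> w \<in> carrier P \<Longrightarrow> foldr push u w \<in> carrier P"
  by (induction u) (auto simp: push_closed)

text \<open>Pushing two syllables of the same factor amounts to pushing their product. Thus both factors act
  on the normal forms, and associativity of the free product follows from associativity in the
  factors.\<close>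

lemma push_Inl_Inl:
  assumes "a \<in> carrier A - {\<one>\<^bsub>A\<^esub>}" "b \<in> carrier A - {\<one>\<^bsub>A\<^esub>}" "w \<in> carrier P"
  shows "push (Inl a) (push (Inl b) w) =
    (if a \<otimes>\<^bsub>A\<^esub> b = \<one>\<^bsub>A\<^esub> then w else push (Inl (a \<otimes>\<^bsub>A\<^esub> b)) w)"
proof (cases w)
  case (Cons t v)
  show ?thesis
  proof (cases t)
    case (Inl c)
    hence c: "c \<in> carrier A" "c \<noteq> \<one>\<^bsub>A\<^esub>"
      using assms(3) Cons free_product_ConsD[of t v A B] by (auto simp: syllables_def)
    have push_v: "push (Inl d) v = Inl d # v" for d
      using assms(3) Cons Inl by (cases v; cases "hd v") auto
    show ?thesis
    proof (cases "b \<otimes>\<^bsub>A\<^esub> c = \<one>\<^bsub>A\<^esub>")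
      case True
      hence "a \<otimes>\<^bsub>A\<^esub> b \<otimes>\<^bsub>A\<^esub> c = a" using assms c by (simp add: A.m_assoc)
      moreover have "c = a" if "a \<otimes>\<^bsub>A\<^esub> b = \<one>\<^bsub>A\<^esub>"
        using calculation c that by simp
      ultimately show ?thesis using True assms Cons Inl push_v by auto
    next
      case False
      have "a \<otimes>\<^bsub>A\<^esub> b \<otimes>\<^bsub>A\<^esub> c = a \<otimes>\<^bsub>A\<^esub> (b \<otimes>\<^bsub>A\<^esub> c)" using assms c by (simp add: A.m_assoc)
      moreover have "a \<otimes>\<^bsub>A\<^esub> (b \<otimes>\<^bsub>A\<^esub> c) = c" if "a \<otimes>\<^bsub>A\<^esub> b = \<one>\<^bsub>A\<^esub>"
        using calculation c that by simp
      ultimately show ?thesis using False assms Cons Inl c by auto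
    qed
  qed (use Cons in auto)
qed auto

lemma push_Inr_Inr:
  assumes "a \<in> carrier B - {\<one>\<^bsub>B\<^esub>}" "b \<in> carrier B - {\<one>\<^bsub>B\<^esub>}" "w \<in> carrier P"
  shows "push (Inr a) (push (Inr b) w) =
    (if a \<otimes>\<^bsub>B\<^esub> b = \<one>\<^bsub>B\<^esub> then w else push (Inr (a \<otimes>\<^bsub>B\<^esub> b)) w)"
proof (cases w)
  case (Cons t v)
  show ?thesis
  proof (cases t)
    case (Inr c)
    hence c: "c \<in> carrier B" "c \<noteq> \<one>\<^bsub>B\<^esub>"
      using assms(3) Cons free_product_ConsD[of t v A B] by (auto simp: syllables_def)
    have push_v: "push (Inr d) v = Inr d # v" for d
      using assms(3) Cons Inr by (cases v; cases "hd v") auto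
    show ?thesis
    proof (cases "b \<otimes>\<^bsub>B\<^esub> c = \<one>\<^bsub>B\<^esub>")
      case True
      hence "a \<otimes>\<^bsub>B\<^esub> b \<otimes>\<^bsub>B\<^esub> c = a" using assms c by (simp add: B.m_assoc)
      moreover have "c = a" if "a \<otimes>\<^bsub>B\<^esub> b = \<one>\<^bsub>B\<^esub>"
        using calculation c that by simp
      ultimately show ?thesis using True assms Cons Inr push_v by auto
    next
      case False
      have "a \<otimes>\<^bsub>B\<^esub> b \<otimes>\<^bsub>B\<^esub> c = a \<otimes>\<^bsub>B\<^esub> (b \<otimes>\<^bsub>B\<^esub> c)" using assms c by (simp add: B.m_assoc)
      moreover have "a \<otimes>\<^bsub>B\<^esub> (b \<otimes>\<^bsub>B\<^esub> c) = c" if "a \<otimes>\<^bsub>B\<^esub> b = \<one>\<^bsub>B\<^esub>"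
        using calculation c that by simp
      ultimately show ?thesis using False assms Cons Inr c by auto
    qed
  qed (use Cons in auto)
qed auto

lemma foldr_push_push:
  assumes "s \<in> syllables A B" "set v \<subseteq> syllables A B" "w \<in> carrier P"
  shows "foldr push (push s v) w = push s (foldr push v w)"
proof (cases v)
  case (Cons t v')
  have w': "foldr push v' w \<in> carrier P"
    using assms Cons by (intro foldr_push_closed) auto
  have t: "t \<in> syllables A B" using assms Cons by auto
  show ?thesis
    using w' Cons push_Inl_Inl[OF _ _ w'] push_Inr_Inr[OF _ _ w']
    by (cases rule: syllables_cases[OF assms(1)]; cases rule: syllables_cases[OF t]) auto
qed (cases s; simp)

lemma foldr_push_assoc:
  assumes "set u \<subseteq> syllables A B" "v \<in> carrier P" "w \<in> carrier P"
  shows "foldr push (foldr push u v) w = foldr push u (foldr push v w)"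
  using assms(1)
proof (induction u)
  case (Cons s u)
  thus ?case
    using foldr_push_push[of s "foldr push u v" w] foldr_push_closed[of u v]
      free_product_set[of "foldr push u v"] assms by auto
qed simp

lemma foldr_push_Nil: "w \<in> carrier P \<Longrightarrow> foldr push w [] = w"
proof (induction w)
  case (Cons s w)
  thus ?case using free_product_ConsD[OF Cons.prems] push_syllable_eq_Cons[OF Cons.prems] by simp
qed simp

lemma push_syllable_inverse_ex:
  assumes "s \<in> syllables A B"
  obtains t where "t \<in> syllables A B" "\<And>w. w \<in> carrier P \<Longrightarrow> push t (push s w) = w"
  using assms
proof (cases rule: syllables_cases)
  case (Inl a)
  hence "inv\<^bsub>A\<^esub> a \<in> carrier A - {\<one>\<^bsub>A\<^esub>}" by (simp add: A.inv_eq_1_iff)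
  thus thesis using Inl push_Inl_Inl[of "inv\<^bsub>A\<^esub> a" a]
    by (intro that[of "Inl (inv\<^bsub>A\<^esub> a)"]) (auto simp: syllables_def)
next
  case (Inr a)
  hence "inv\<^bsub>B\<^esub> a \<in> carrier B - {\<one>\<^bsub>B\<^esub>}" by (simp add: B.inv_eq_1_iff)
  thus thesis using Inr push_Inr_Inr[of "inv\<^bsub>B\<^esub> a" a]
    by (intro that[of "Inr (inv\<^bsub>B\<^esub> a)"]) (auto simp: syllables_def)
qed

lemma left_inverse_ex:
  "set u \<subseteq> syllables A B \<Longrightarrow> \<exists>v\<in>carrier P. \<forall>w\<in>carrier P. foldr push v (foldr push u w) = w"
proof (induction u)
  case Nil
  show ?case by (auto intro!: bexI[of _ "[]"])
next
  case (Cons s u)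
  then obtain v where v: "v \<in> carrier P" "\<forall>w\<in>carrier P. foldr push v (foldr push u w) = w"
    by auto
  obtain t where t: "t \<in> syllables A B" "\<And>w. w \<in> carrier P \<Longrightarrow> push t (push s w) = w"
    using push_syllable_inverse_ex[of s] Cons.prems by auto
  have "foldr push (foldr push v [t]) (foldr push (s # u) w) = w" if "w \<in> carrier P" for w
    using that v t Cons.prems free_product_set[OF v(1)]
    by (simp add: foldr_push_assoc push_closed foldr_push_closed)
  thus ?case using v(1) t(1) free_product_set[OF v(1)]
    by (intro bexI[of _ "foldr push v [t]"]) (auto intro: foldr_push_closed)
qed

lemma group_free_product: "group P"
proof (rule groupI)
  fix u v assume u: "u \<in> carrier P" and v: "v \<in> carrier P"
  show "u \<otimes>\<^bsub>P\<^esub> v \<in> carrier P"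
    using foldr_push_closed[OF free_product_set[OF u] v] by (simp add: free_product_simps(2))
  show "u \<otimes>\<^bsub>P\<^esub> v \<otimes>\<^bsub>P\<^esub> w = u \<otimes>\<^bsub>P\<^esub> (v \<otimes>\<^bsub>P\<^esub> w)" if "w \<in> carrier P" for w
    using foldr_push_assoc[OF free_product_set[OF u] v that] by (simp add: free_product_simps(2))
  show "\<exists>y\<in>carrier P. y \<otimes>\<^bsub>P\<^esub> u = \<one>\<^bsub>P\<^esub>"
    using left_inverse_ex[OF free_product_set[OF u]] foldr_push_Nil[OF u]
    by (metis free_product_carrier_simps(1) free_product_simps(2,3))
qed (auto simp: free_product_simps(2,3))

lemma fp_inl_hom: "fp_inl A \<in> hom A P"
  by (auto simp: hom_def fp_inl_def free_product_simps(2) syllables_def)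

lemma fp_inr_hom: "fp_inr B \<in> hom B P"
  by (auto simp: hom_def fp_inr_def free_product_simps(2) syllables_def)

lemma generated_by_factors:
  assumes "subgroup K P" "fp_inl A ` carrier A \<subseteq> K" "fp_inr B ` carrier B \<subseteq> K"
  shows "K = carrier P"
proof
  show "K \<subseteq> carrier P" by (rule subgroup.subset[OF assms(1)])
  have "w \<in> K" if "w \<in> carrier P" for w
    using that
  proof (induction w)
    case Nil
    show ?case using subgroup.one_closed[OF assms(1)] by (simp add: free_product_simps)
  next
    case (Cons s w)
    note s = free_product_ConsD[OF Cons.prems]
    have "[s] \<in> K"
    proof (cases rule: syllables_cases[OF conjunct1[OF s]])
      case (1 a)
      hence "fp_inl A a \<in> K" using assms(2) by blast
      thus ?thesis using 1 by (simp add: fp_inl_def)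
    next
      case (2 b)
      hence "fp_inr B b \<in> K" using assms(3) by blast
      thus ?thesis using 2 by (simp add: fp_inr_def)
    qed
    moreover have "w \<in> K" using s Cons.IH by blast
    ultimately have "[s] \<otimes>\<^bsub>P\<^esub> w \<in> K" by (rule subgroup.m_closed[OF assms(1)])
    thus ?case using push_syllable_eq_Cons[OF Cons.prems] by (simp add: free_product_simps(2))
  qed
  thus "carrier P \<subseteq> K" ..
qed

end

text \<open>The homomorphism from a free product that the universal property assigns to homomorphisms from
  the two factors.\<close>

definition copair ::
  "('k, 'l) monoid_scheme \<Rightarrow> ('g \<Rightarrow> 'k) \<Rightarrow> ('h \<Rightarrow> 'k) \<Rightarrow> ('g + 'h) list \<Rightarrow> 'k" where
  "copair K f h w = foldr (\<lambda>s a. case_sum f h s \<otimes>\<^bsub>K\<^esub> a) w \<one>\<^bsub>K\<^esub>"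

lemma copair_hom:
  assumes "group A" "group B" "group K" "f \<in> hom A K" "h \<in> hom B K"
  shows "copair K f h \<in> hom (free_product A B) K"
proof -
  interpret two_groups A B using assms by (simp add: two_groups_def)
  interpret K: group K by fact
  interpret f: group_hom A K f using assms(4) by unfold_locales
  interpret h: group_hom B K h using assms(5) by unfold_locales
  have Cons: "copair K f h (s # w) = case_sum f h s \<otimes>\<^bsub>K\<^esub> copair K f h w" for s w
    by (simp add: copair_def)
  have Nil: "copair K f h [] = \<one>\<^bsub>K\<^esub>" by (simp add: copair_def)
  have val: "case_sum f h s \<in> carrier K" if "s \<in> syllables A B" for s
    using that by (auto simp: syllables_def)
  have closed: "copair K f h w \<in> carrier K" if "set w \<subseteq> syllables A B" for w
    using that by (induction w) (auto simp: Cons Nil val)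
  have push: "copair K f h (push s w) = case_sum f h s \<otimes>\<^bsub>K\<^esub> copair K f h w"
    if "s \<in> syllables A B" "set w \<subseteq> syllables A B" for s w
  proof (cases w)
    case w: (Cons t v)
    have t: "t \<in> syllables A B" and v: "copair K f h v \<in> carrier K"
      using that w by (auto intro: closed)
    have inl: "f a \<otimes>\<^bsub>K\<^esub> (f b \<otimes>\<^bsub>K\<^esub> copair K f h v) = f (a \<otimes>\<^bsub>A\<^esub> b) \<otimes>\<^bsub>K\<^esub> copair K f h v"
      if "a \<in> carrier A" "b \<in> carrier A" for a b using that v by (simp add: K.m_assoc)
    have inr: "h a \<otimes>\<^bsub>K\<^esub> (h b \<otimes>\<^bsub>K\<^esub> copair K f h v) = h (a \<otimes>\<^bsub>B\<^esub> b) \<otimes>\<^bsub>K\<^esub> copair K f h v"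
      if "a \<in> carrier B" "b \<in> carrier B" for a b using that v by (simp add: K.m_assoc)
    show ?thesis
      using v by (cases rule: syllables_cases[OF that(1)]; cases rule: syllables_cases[OF t])
        (auto simp: w Cons inl inr simp del: f.hom_mult h.hom_mult)
  qed (cases s; simp add: Cons Nil)
  have "copair K f h (foldr push u v) = copair K f h u \<otimes>\<^bsub>K\<^esub> copair K f h v"
    if "set u \<subseteq> syllables A B" "v \<in> carrier P" for u v
    using that(1)
  proof (induction u)
    case (Cons s u)
    thus ?case using that(2) free_product_set[OF foldr_push_closed[of u v]]
      by (simp add: push \<open>\<And>s w. copair K f h (s # w) = _\<close> K.m_assoc closed val free_product_set)
  qed (use that(2) in \<open>simp add: Nil closed free_product_set\<close>)
  thus ?thesis
    by (auto simp: hom_def free_product_simps(2) intro!: closed dest: free_product_set)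
qed

lemma copair_fp_inl:
  assumes "group A" "group K" "f \<in> hom A K" "a \<in> carrier A"
  shows "copair K f h (fp_inl A a) = f a"
proof -
  interpret f: group_hom A K f using assms by (simp add: group_hom_def group_hom_axioms_def)
  show ?thesis using assms(4) by (simp add: copair_def fp_inl_def)
qed

lemma copair_fp_inr:
  assumes "group B" "group K" "h \<in> hom B K" "b \<in> carrier B"
  shows "copair K f h (fp_inr B b) = h b"
proof -
  interpret h: group_hom B K h using assms by (simp add: group_hom_def group_hom_axioms_def)
  show ?thesis using assms(4) by (simp add: copair_def fp_inr_def)
qed


section \<open>Recursive functions on coded lists\<close>

lemma computes_Proj: "i < length xs \<Longrightarrow> xs ! i = y \<Longrightarrow> computes (Proj i) xs y"
  using computes.intros(3) by blast

lemma computes_Comp1: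
  "computes q xs y \<Longrightarrow> computes p [y] z \<Longrightarrow> computes (Comp p [q]) xs z"
  by (rule computes.intros(4)[of xs _ "[y]"]) auto

lemma computes_Comp2:
  "computes q xs y \<Longrightarrow> computes q' xs y' \<Longrightarrow> computes p [y, y'] z \<Longrightarrow>
     computes (Comp p [q, q']) xs z"
  by (rule computes.intros(4)[of xs _ "[y, y']"]) auto

lemma computes_Comp3:
  "computes q xs y \<Longrightarrow> computes q' xs y' \<Longrightarrow> computes q'' xs y'' \<Longrightarrow>
     computes p [y, y', y''] z \<Longrightarrow> computes (Comp p [q, q', q'']) xs z"
  by (rule computes.intros(4)[of xs _ "[y, y', y'']"]) auto

lemma computes_PrimRec:
  assumes "computes p xs (f 0)"
    and "\<And>k. k < n \<Longrightarrow> computes q (k # f k # xs) (f (Suc k))"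
  shows "computes (PrimRec p q) (n # xs) (f n)"
  using assms(2) by (induction n) (auto intro: computes.intros(5,6) assms(1) less_SucI)

lemma computes_Mu:
  assumes "\<And>m. m \<le> n \<Longrightarrow> computes p (m # xs) (f m)"
    and "f n = 0" "\<And>m. m < n \<Longrightarrow> f m \<noteq> 0"
  shows "computes (Mu p) xs n"
proof (rule computes.intros(7))
  show "computes p (n # xs) 0" using assms(1)[of n] assms(2) by simp
  show "\<forall>m<n. \<exists>y. computes p (m # xs) (Suc y)"
    using assms(1,3) by (metis less_imp_le not0_implies_Suc)
qed

lemmas computes_basic =
  computes.intros(1,2) computes_Proj computes_Comp1 computes_Comp2 computes_Comp3

text \<open>In a step of a primitive recursion the arguments are the counter, the previous value and the
  parameters, in this order. Subtraction and addition recurse on their first argument.\<close>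

definition "pred_prog = PrimRec Zero (Proj 0)"
definition "monus_prog = PrimRec (Proj 0) (Comp pred_prog [Proj 1])"
definition "add_prog = PrimRec (Proj 0) (Comp Succ [Proj 1])"
definition "triangle_prog = PrimRec Zero (Comp Succ [Comp add_prog [Proj 0, Proj 1]])"

lemma computes_pred: "computes pred_prog [n] (n - 1)"
  unfolding pred_prog_def
  by (rule computes_PrimRec[where f = "\<lambda>n. n - 1"]) (auto intro!: computes_basic)

lemma computes_monus: "computes monus_prog [y, x] (x - y)"
  unfolding monus_prog_def
proof (rule computes_PrimRec[where f = "\<lambda>y. x - y"])
  fix k
  show "computes (Comp pred_prog [Proj 1]) [k, x - k, x] (x - Suc k)"
    using computes_pred[of "x - k"] by (auto intro!: computes_basic)
qed (auto intro!: computes_basic)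

lemma computes_add: "computes add_prog [y, x] (x + y)"
  unfolding add_prog_def
proof (rule computes_PrimRec[where f = "\<lambda>y. x + y"])
  fix k
  show "computes (Comp Succ [Proj 1]) [k, x + k, x] (x + Suc k)"
    using computes.intros(2)[of "x + k"] by (auto intro!: computes_Comp1 computes_Proj)
qed (auto intro!: computes_basic)

lemma computes_triangle: "computes triangle_prog [n] (triangle n)"
  unfolding triangle_prog_def
proof (rule computes_PrimRec[where f = triangle])
  fix k
  show "computes (Comp Succ [Comp add_prog [Proj 0, Proj 1]]) [k, triangle k] (triangle (Suc k))"
    using computes.intros(2)[of "triangle k + k"]
    by (auto intro!: computes_Comp1 computes_Comp2[OF _ _ computes_add] computes_Proj)
qed (auto intro!: computes_basic)

text \<open>The code of \<open>(a, b)\<close> is \<open>triangle (a + b) + a\<close>, and \<open>a\<close> is less than the gap \<open>a + b + 1\<close> to the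
  next triangular number. So \<open>a + b\<close> is the least \<open>s\<close> for which \<open>triangle (s + 1)\<close> exceeds the code,
  found by unbounded search; \<open>a\<close> and \<open>b\<close> follow by subtraction.\<close>

definition "diagonal_prog =
  Mu (Comp monus_prog [Comp triangle_prog [Comp Succ [Proj 0]], Comp Succ [Proj 1]])"
definition "fst_prog = Comp monus_prog [Comp triangle_prog [diagonal_prog], Proj 0]"
definition "snd_prog = Comp monus_prog [fst_prog, diagonal_prog]"

lemma triangle_mono: "m \<le> n \<Longrightarrow> triangle m \<le> triangle n"
  unfolding triangle_def by (intro div_le_mono mult_le_mono) auto

lemma computes_diagonal: "computes diagonal_prog [prod_encode (a, b)] (a + b)"
  unfolding diagonal_prog_def
proof (rule computes_Mu)
  let ?z = "prod_encode (a, b)"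
  fix m
  show "computes (Comp monus_prog [Comp triangle_prog [Comp Succ [Proj 0]], Comp Succ [Proj 1]])
      [m, ?z] (Suc ?z - triangle (Suc m))"
    by (intro computes_Comp2[OF _ _ computes_monus] computes_Comp1[OF _ computes_triangle]
        computes_Comp1[OF _ computes.intros(2)] computes_Proj) auto
  show "Suc ?z - triangle (Suc m) \<noteq> 0" if "m < a + b"
    using triangle_mono[of "Suc m" "a + b"] that by (simp add: prod_encode_def)
qed (simp add: prod_encode_def)

lemma computes_fst: "computes fst_prog [prod_encode (a, b)] a"
proof -
  have "computes monus_prog [triangle (a + b), prod_encode (a, b)] a"
    using computes_monus[of "triangle (a + b)" "prod_encode (a, b)"] by (simp add: prod_encode_def)
  thus ?thesis unfolding fst_prog_def
    by (auto intro!: computes_basic computes_triangle computes_diagonal)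
qed

lemma computes_snd: "computes snd_prog [prod_encode (a, b)] b"
  unfolding snd_prog_def using computes_monus[of a "a + b"]
  by (auto intro!: computes_Comp2[OF computes_fst computes_diagonal])

text \<open>The code of a nonempty list is one more than the code of the pair of its head and the code of its
  tail, and \<open>0\<close> is the code of the empty list. Since \<open>0\<close> also encodes the pair \<open>(0, 0)\<close>, the tail of
  the empty list comes out as the empty list, and the length of a list is the least number of
  tails that leads to \<open>0\<close>.\<close>

definition "cons_prog =
  Comp Succ [Comp add_prog [Proj 0, Comp triangle_prog [Comp add_prog [Proj 0, Proj 1]]]]"
definition "hd_prog = Comp fst_prog [pred_prog]"
definition "tl_prog = Comp snd_prog [pred_prog]"
definition "drop_prog = PrimRec (Proj 0) (Comp tl_prog [Proj 1])"
definition "nth_prog = Comp hd_prog [drop_prog]"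
definition "length_prog = Mu drop_prog"

lemma computes_cons: "computes cons_prog [x, list_encode xs] (list_encode (x # xs))"
proof -
  have "prod_encode (x, list_encode xs) = triangle (list_encode xs + x) + x"
    by (simp add: prod_encode_def add.commute)
  thus ?thesis unfolding cons_prog_def list_encode.simps
    by (auto simp del: triangle_Suc
      intro!: computes_Comp1[OF _ computes.intros(2)] computes_Comp2[OF _ _ computes_add]
        computes_Comp1[OF _ computes_triangle] computes_Proj)
qed

lemma computes_hd: "computes hd_prog [list_encode (x # xs)] x"
  unfolding hd_prog_def
  using computes_pred[of "list_encode (x # xs)"] by (auto intro!: computes_basic computes_fst)

lemma computes_tl: "computes tl_prog [list_encode xs] (list_encode (tl xs))"
proof (cases xs)
  case Nil
  have "prod_encode (0, 0) = 0" by (simp add: prod_encode_def)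
  thus ?thesis unfolding tl_prog_def
    using computes_pred[of 0] computes_snd[of 0 0] Nil by (auto intro!: computes_basic)
next
  case (Cons y ys)
  thus ?thesis unfolding tl_prog_def
    using computes_pred[of "list_encode xs"] by (auto intro!: computes_basic computes_snd)
qed

lemma computes_drop: "computes drop_prog [n, list_encode xs] (list_encode (drop n xs))"
  unfolding drop_prog_def
proof (rule computes_PrimRec[where f = "\<lambda>n. list_encode (drop n xs)"])
  fix k
  show "computes (Comp tl_prog [Proj 1]) [k, list_encode (drop k xs), list_encode xs]
      (list_encode (drop (Suc k) xs))"
    using computes_tl[of "drop k xs"] by (auto simp: drop_Suc tl_drop intro!: computes_basic)
qed (auto intro!: computes_basic)

lemma computes_nth:
  assumes "n < length xs"
  shows "computes nth_prog [n, list_encode xs] (xs ! n)"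
proof -
  have "computes hd_prog [list_encode (drop n xs)] (xs ! n)"
    using computes_hd[of "xs ! n" "drop (Suc n) xs"] assms by (simp only: Cons_nth_drop_Suc)
  thus ?thesis unfolding nth_prog_def by (intro computes_Comp1[OF computes_drop])
qed

lemma computes_length: "computes length_prog [list_encode xs] (length xs)"
  unfolding length_prog_def
proof (rule computes_Mu[OF computes_drop])
  show "list_encode (drop m xs) \<noteq> 0" if "m < length xs" for m
    using Cons_nth_drop_Suc[OF that] by (metis list_encode.simps(2) nat.distinct(2))
qed auto

text \<open>A loop that walks through a list from the front can only push entries onto an accumulator, which
  reverses their order. Prefixes and extensions at the end are obtained by reversing twice.\<close>

definition "rev_take_onto_prog =
  PrimRec (Proj 0) (Comp cons_prog [Comp nth_prog [Proj 0, Proj 3], Proj 1])"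
definition "rev_onto_prog =
  Comp rev_take_onto_prog [Comp length_prog [Proj 0], Proj 1, Proj 0]"
definition "take_prog =
  Comp rev_onto_prog [Comp rev_take_onto_prog [Proj 0, Zero, Proj 1], Zero]"
definition "snoc_prog =
  Comp rev_onto_prog [Comp rev_onto_prog [Proj 0, Zero], Comp cons_prog [Proj 1, Zero]]"

lemma computes_Zero_Nil: "computes Zero xs (list_encode [])"
  by (simp add: computes.intros)

lemma computes_rev_take_onto:
  assumes "n \<le> length xs"
  shows "computes rev_take_onto_prog [n, list_encode ys, list_encode xs]
           (list_encode (rev (take n xs) @ ys))"
  unfolding rev_take_onto_prog_def
proof (rule computes_PrimRec[where f = "\<lambda>n. list_encode (rev (take n xs) @ ys)"])
  fix k assume "k < n"
  hence k: "k < length xs" using assms by simp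
  have "computes (Comp nth_prog [Proj 0, Proj 3])
      [k, list_encode (rev (take k xs) @ ys), list_encode ys, list_encode xs] (xs ! k)"
    by (rule computes_Comp2[OF _ _ computes_nth[OF k]]) (auto intro!: computes_Proj)
  from computes_Comp2[OF this computes_Proj computes_cons[of _ "rev (take k xs) @ ys"], of 1]
  show "computes (Comp cons_prog [Comp nth_prog [Proj 0, Proj 3], Proj 1])
      [k, list_encode (rev (take k xs) @ ys), list_encode ys, list_encode xs]
      (list_encode (rev (take (Suc k) xs) @ ys))"
    using k by (simp add: take_Suc_conv_app_nth)
qed (auto intro!: computes_Proj)

lemma computes_rev_onto:
  "computes rev_onto_prog [list_encode xs, list_encode ys] (list_encode (rev xs @ ys))"
  unfolding rev_onto_prog_def
  using computes_rev_take_onto[of "length xs" xs ys]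
  by (intro computes_Comp3[OF computes_Comp1[OF _ computes_length]] computes_Proj) auto

lemma computes_take:
  assumes "n \<le> length xs"
  shows "computes take_prog [n, list_encode xs] (list_encode (take n xs))"
proof -
  have "computes (Comp rev_take_onto_prog [Proj 0, Zero, Proj 1]) [n, list_encode xs]
      (list_encode (rev (take n xs) @ []))"
    by (rule computes_Comp3[OF _ computes_Zero_Nil _ computes_rev_take_onto[OF assms]])
      (auto intro!: computes_Proj)
  from computes_Comp2[OF this computes_Zero_Nil computes_rev_onto]
  show ?thesis unfolding take_prog_def by simp
qed

lemma computes_snoc: "computes snoc_prog [list_encode xs, x] (list_encode (xs @ [x]))"
proof -
  have "computes (Comp rev_onto_prog [Proj 0, Zero]) [list_encode xs, x] (list_encode (rev xs @ []))"
    by (rule computes_Comp2[OF _ computes_Zero_Nil computes_rev_onto]) (auto intro!: computes_Proj)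
  moreover have "computes (Comp cons_prog [Proj 1, Zero]) [list_encode xs, x] (list_encode [x])"
    by (rule computes_Comp2[OF _ computes_Zero_Nil computes_cons]) (auto intro!: computes_Proj)
  ultimately show ?thesis
    unfolding snoc_prog_def using computes_Comp2[OF _ _ computes_rev_onto] by fastforce
qed

text \<open>Runs \<open>p\<close> on every entry of a list together with the entries before it, and concatenates the
  resulting lists. Each result is reversed onto the accumulator of the earlier ones; for a list of
  relators only the set of entries matters, whatever their order.\<close>

definition "scan_prog p = Comp
  (PrimRec Zero (Comp rev_onto_prog
     [Comp p [Comp take_prog [Proj 0, Proj 2], Comp nth_prog [Proj 0, Proj 2]], Proj 1]))
  [length_prog, Proj 0]"

lemma computes_scan:
  assumes "\<And>i. i < length xs \<Longrightarrow> computes p [list_encode (take i xs), xs ! i] (list_encode (f i))"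
  shows "computes (scan_prog p) [list_encode xs]
           (list_encode (concat (map (\<lambda>i. rev (f i)) (rev [0..<length xs]))))"
proof -
  define acc where "acc = (\<lambda>n. concat (map (\<lambda>i. rev (f i)) (rev [0..<n])))"
  have "computes (PrimRec Zero (Comp rev_onto_prog
     [Comp p [Comp take_prog [Proj 0, Proj 2], Comp nth_prog [Proj 0, Proj 2]], Proj 1]))
     [length xs, list_encode xs] (list_encode (acc (length xs)))"
  proof (rule computes_PrimRec[where f = "\<lambda>n. list_encode (acc n)"])
    fix k assume k: "k < length xs"
    let ?args = "[k, list_encode (acc k), list_encode xs]"
    have "computes (Comp take_prog [Proj 0, Proj 2]) ?args (list_encode (take k xs))"
      using k by (intro computes_Comp2[OF _ _ computes_take] computes_Proj) auto
    moreover have "computes (Comp nth_prog [Proj 0, Proj 2]) ?args (xs ! k)"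
      using k by (intro computes_Comp2[OF _ _ computes_nth] computes_Proj) auto
    ultimately have "computes (Comp p [Comp take_prog [Proj 0, Proj 2], Comp nth_prog [Proj 0, Proj 2]])
        ?args (list_encode (f k))"
      using assms[OF k] by (rule computes_Comp2)
    moreover have "acc (Suc k) = rev (f k) @ acc k" by (simp add: acc_def)
    moreover note computes_Comp2[OF calculation(1) computes_Proj computes_rev_onto[of _ "acc k"], of 1]
    ultimately show "computes (Comp rev_onto_prog
        [Comp p [Comp take_prog [Proj 0, Proj 2], Comp nth_prog [Proj 0, Proj 2]], Proj 1])
        ?args (list_encode (acc (Suc k)))"
      by simp
  qed (simp add: acc_def computes.intros)
  thus ?thesis unfolding scan_prog_def acc_def
    by (intro computes_Comp2[OF computes_length computes_Proj]) auto
qed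


section \<open>The ideal of an element as a kernel\<close>

text \<open>Words in elements of a subgroup have the same value in the subgroup and in the whole group, so
  for the subgroup generated by \<open>gs\<close> the only content of a presentation is which words die in
  \<open>G\<close>.\<close>

lemma is_presentation_subgroup_iff:
  assumes "group G" "set gs \<subseteq> carrier G"
  shows "is_presentation (G\<lparr>carrier := generate G (set gs)\<rparr>) gs R \<longleftrightarrow>
    finite R \<and> R \<subseteq> carrier (free_group {..<length gs}) \<and>
    {w \<in> carrier (free_group {..<length gs}). word_eval G gs w = \<one>\<^bsub>G\<^esub>} =
      normal_closure (free_group {..<length gs}) R"
proof -
  interpret group G by fact
  let ?H = "generate G (set gs)"
  have H: "subgroup ?H G" using assms(2) by (rule generate_is_subgroup)
  have gs: "set gs \<subseteq> ?H" by (auto intro: generate.incl)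
  have "kernel (free_group {..<length gs}) (G\<lparr>carrier := ?H\<rparr>) (word_eval (G\<lparr>carrier := ?H\<rparr>) gs)
      = {w \<in> carrier (free_group {..<length gs}). word_eval G gs w = \<one>\<^bsub>G\<^esub>}"
    using word_eval_subgroup[OF assms(1) H gs] by (auto simp: kernel_def free_group_simps)
  thus ?thesis
    unfolding is_presentation_def using gs generate_consistent[OF gs H] by auto
qed

text \<open>The setting of both directions: with \<open>H = \<langle>h\<^sub>0, \<dots>, h\<^sub>r\<^sub>-\<^sub>1\<rangle>\<close>, the map \<open>to_eqn\<close> is the epimorphism
  \<open>\<F>\<^sub>r\<^sub>+\<^sub>1 \<rightarrow> H * \<langle>x\<rangle>\<close> that sends \<open>x\<^sub>i\<close> to \<open>h\<^sub>i\<close> and the last free generator to \<open>x\<close>. It translates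
  between equations over \<open>H\<close> and words.\<close>

locale subgroup_gens = group G for G :: "('g, 'm) monoid_scheme" (structure) +
  fixes hs :: "'g list"
  assumes hs_carrier: "set hs \<subseteq> carrier G"
begin

abbreviation "H \<equiv> generate G (set hs)"
abbreviation "E \<equiv> eqn_group G H"
abbreviation "Fr \<equiv> free_group {..<length hs}"
abbreviation "Fx \<equiv> free_group {..<Suc (length hs)}"
abbreviation "eqn_gens \<equiv> map (eqn_const G) hs @ [eqn_var]"
abbreviation "to_eqn \<equiv> word_eval E eqn_gens"

lemma H_subgroup: "subgroup H G"
  using hs_carrier by (rule generate_is_subgroup)

lemma group_H: "group (G\<lparr>carrier := H\<rparr>)"
  by (rule subgroup_imp_group[OF H_subgroup])

lemma hs_H: "set hs \<subseteq> H"
  by (auto intro: generate.incl)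

sublocale HZ: two_groups "G\<lparr>carrier := H\<rparr>" integer_group
  using group_H by (simp add: two_groups_def)

lemma eqn_group_eq: "E = free_product (G\<lparr>carrier := H\<rparr>) integer_group"
  by (simp add: eqn_group_def)

lemma eqn_const_eq: "eqn_const G = fp_inl (G\<lparr>carrier := H\<rparr>)"
  by (simp add: eqn_const_def fp_inl_def fun_eq_iff)

lemma eqn_var_eq: "eqn_var = fp_inr integer_group 1"
  by (simp add: eqn_var_def fp_inr_def)

sublocale E: group E
  unfolding eqn_group_eq by (rule HZ.group_free_product)

lemma const_hom: "eqn_const G \<in> hom (G\<lparr>carrier := H\<rparr>) E"
  unfolding eqn_group_eq eqn_const_eq by (rule HZ.fp_inl_hom)

lemma inr_hom: "fp_inr integer_group \<in> hom integer_group E"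
  unfolding eqn_group_eq by (rule HZ.fp_inr_hom)

lemma eqn_gens_carrier: "set eqn_gens \<subseteq> carrier E"
  using const_hom inr_hom hs_H unfolding eqn_var_eq by (auto simp: hom_def)

lemma to_eqn_hom: "to_eqn \<in> hom Fx E"
  using E.word_eval_hom[OF eqn_gens_carrier] by simp

lemma to_eqn_const:
  assumes "w \<in> words {..<length hs}"
  shows "to_eqn w = eqn_const G (word_eval G hs w)"
proof -
  have "to_eqn w = word_eval E (map (eqn_const G) hs) w"
    using assms by (intro word_eval_append_gens) simp
  also have "\<dots> = eqn_const G (word_eval (G\<lparr>carrier := H\<rparr>) hs w)"
    using assms hs_H by (intro hom_word_eval[symmetric, OF group_H E.group_axioms const_hom]) auto
  also have "word_eval (G\<lparr>carrier := H\<rparr>) hs w = word_eval G hs w"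
    by (rule word_eval_subgroup[OF group_axioms H_subgroup hs_H assms])
  finally show ?thesis .
qed

lemma Fr_subset: "carrier Fr \<subseteq> carrier Fx"
  by (auto simp: free_group_simps words_def)

lemma to_eqn_image: "to_eqn ` carrier Fx = carrier E"
proof -
  interpret h: group_hom Fx E to_eqn
    using to_eqn_hom group_free_group E.group_axioms
    by (simp add: group_hom_def group_hom_axioms_def)
  interpret r: group_hom integer_group E "fp_inr integer_group"
    using inr_hom E.group_axioms by (simp add: group_hom_def group_hom_axioms_def)
  let ?K = "to_eqn ` carrier Fx"
  have K: "subgroup ?K E" by (rule h.img_is_subgroup)
  have "to_eqn [(length hs, True)] = eqn_var \<otimes>\<^bsub>E\<^esub> \<one>\<^bsub>E\<^esub>" by (simp add: nth_append)
  moreover have "eqn_var \<in> carrier E" using eqn_gens_carrier by simp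
  moreover have "[(length hs, True)] \<in> carrier Fx" by (simp add: free_group_simps)
  ultimately have var: "fp_inr integer_group 1 \<in> ?K"
    unfolding eqn_var_eq by (metis E.r_one imageI)
  have "eqn_const G h \<in> ?K" if "h \<in> H" for h
  proof -
    have "h \<in> word_eval G hs ` carrier Fr"
      using that unfolding word_eval_image[OF hs_carrier] .
    then obtain w where w: "w \<in> carrier Fr" and h: "h = word_eval G hs w" ..
    have "w \<in> words {..<length hs}" using w by (simp add: free_group_simps)
    hence "eqn_const G h = to_eqn w" unfolding h by (rule to_eqn_const[symmetric])
    moreover have "w \<in> carrier Fx" using w Fr_subset by blast
    ultimately show ?thesis by (rule image_eqI)
  qed
  moreover have "fp_inr integer_group k \<in> ?K" for k
  proof (induction k rule: int_induct[where k = 0])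
    case base
    show ?case using subgroup.one_closed[OF K] r.hom_one by simp
  next
    case (step1 i)
    show ?case
      using subgroup.m_closed[OF K step1(2) var] r.hom_mult[of i 1] by simp
  next
    case (step2 i)
    show ?case
      using subgroup.m_closed[OF K step2(2) subgroup.m_inv_closed[OF K var]]
        r.hom_mult[of i "-1"] r.hom_inv[of 1] by simp
  qed
  ultimately have "eqn_const G ` H \<subseteq> ?K" "range (fp_inr integer_group) \<subseteq> ?K" by blast+
  with K show ?thesis
    unfolding eqn_group_eq eqn_const_eq by (intro HZ.generated_by_factors) auto
qed

text \<open>Relators of \<open>H\<close> also present \<open>H * \<langle>x\<rangle>\<close>, with one more free generator. To see that a word
  killed by \<open>to_eqn\<close> lies in the normal closure \<open>N\<close> of \<open>R\<close> in \<open>\<F>\<^sub>r\<^sub>+\<^sub>1\<close>, a homomorphism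
  \<open>\<theta> : H * \<langle>x\<rangle> \<rightarrow> \<F>\<^sub>r\<^sub>+\<^sub>1 / N\<close> is built from the universal property of the free product: an element
  of \<open>H\<close> goes to the class of any word in \<open>\<F>\<^sub>r\<close> that represents it, which is well defined because
  two such words differ by an element of the kernel of \<open>\<F>\<^sub>r \<rightarrow> H\<close>. Then \<open>\<theta>\<close> composed with
  \<open>to_eqn\<close> agrees with the quotient map on the free generators, hence everywhere.\<close>

lemma to_eqn_kernel:
  assumes "is_presentation (G\<lparr>carrier := H\<rparr>) hs R"
  shows "kernel Fx E to_eqn = normal_closure Fx R"
proof
  note R = assms[unfolded is_presentation_subgroup_iff[OF group_axioms hs_carrier]]
  let ?N = "normal_closure Fx R"
  interpret Fr: group Fr by (rule group_free_group)
  interpret Fx: group Fx by (rule group_free_group)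
  note sub = Fr_subset
  have incl: "(\<lambda>w. w) \<in> hom Fr Fx" using sub by (auto simp: hom_def free_group_simps)
  have Rx: "R \<subseteq> carrier Fx" using R sub by blast
  interpret h: group_hom Fx E to_eqn
    using to_eqn_hom by unfold_locales
  have "to_eqn w = \<one>\<^bsub>E\<^esub>" if "w \<in> R" for w
  proof -
    have "w \<in> {w \<in> carrier Fr. word_eval G hs w = \<one>}"
      using that R normal_closure_incl[of R Fr] by blast
    hence "to_eqn w = eqn_const G \<one>" by (simp add: to_eqn_const free_group_simps)
    thus ?thesis by (simp add: eqn_const_def eqn_group_eq free_product_simps(3))
  qed
  hence "R \<subseteq> kernel Fx E to_eqn" using Rx by (auto simp: kernel_def)
  thus "?N \<subseteq> kernel Fx E to_eqn" by (rule normal_closure_minimal[OF h.normal_kernel])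
  have N: "?N \<lhd> Fx" by (rule normal_closure_normal[OF Fx.group_axioms Rx])
  then interpret N: normal ?N Fx .
  define Q where "Q = Fx Mod ?N"
  interpret Q: group Q unfolding Q_def by (rule N.factorgroup_is_group)
  define \<pi> where "\<pi> = (\<lambda>w. ?N #>\<^bsub>Fx\<^esub> w)"
  have \<pi>_hom: "\<pi> \<in> hom Fx Q" unfolding \<pi>_def Q_def by (rule N.r_coset_hom_Mod)
  interpret \<pi>: group_hom Fx Q \<pi> using \<pi>_hom by unfold_locales
  have \<pi>_one: "\<pi> w = \<one>\<^bsub>Q\<^esub> \<longleftrightarrow> w \<in> ?N" if "w \<in> carrier Fx" for w
    using r_coset_eq_normal[OF N that] by (simp add: \<pi>_def Q_def FactGroup_def)
  have ker_r: "w \<in> ?N" if "w \<in> carrier Fr" "word_eval G hs w = \<one>" for w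
  proof -
    have "w \<in> normal_closure Fr R" using that R by blast
    moreover have "(\<lambda>w. w) ` normal_closure Fr R \<subseteq> ?N"
      using R normal_closure_incl[of R Fx]
      by (intro image_normal_closure_subset[OF Fr.group_axioms Fx.group_axioms incl _ N]) auto
    ultimately show ?thesis by blast
  qed
  have evr: "word_eval G hs \<in> hom Fr G" by (rule word_eval_hom[OF hs_carrier])
  interpret ev: group_hom Fr G "word_eval G hs" using evr by unfold_locales
  have \<pi>_eq: "\<pi> w = \<pi> w'"
    if "w \<in> carrier Fr" "w' \<in> carrier Fr" "word_eval G hs w = word_eval G hs w'" for w w'
  proof -
    let ?d = "w \<otimes>\<^bsub>Fr\<^esub> inv\<^bsub>Fr\<^esub> w'"
    have d: "?d \<in> carrier Fr" using that by simp
    have "word_eval G hs ?d = \<one>" using that by simp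
    hence "\<pi> ?d = \<one>\<^bsub>Q\<^esub>" using ker_r[OF d] \<pi>_one d sub by blast
    hence "\<pi> (?d \<otimes>\<^bsub>Fx\<^esub> w') = \<pi> w'" using d that sub by (simp add: subset_iff)
    moreover have "?d \<otimes>\<^bsub>Fx\<^esub> w' = ?d \<otimes>\<^bsub>Fr\<^esub> w'" by (simp add: free_group_simps)
    moreover have "?d \<otimes>\<^bsub>Fr\<^esub> w' = w" using that by (simp add: Fr.m_assoc)
    ultimately show ?thesis by simp
  qed
  have "\<forall>h\<in>H. \<exists>w. w \<in> carrier Fr \<and> word_eval G hs w = h"
    unfolding word_eval_image[OF hs_carrier, symmetric] by blast
  then obtain lift where
    lift: "\<And>h. h \<in> H \<Longrightarrow> lift h \<in> carrier Fr" "\<And>h. h \<in> H \<Longrightarrow> word_eval G hs (lift h) = h"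
    by metis
  have \<pi>_lift: "\<pi> (lift h) = \<pi> w" if "h \<in> H" "w \<in> carrier Fr" "word_eval G hs w = h" for h w
    using that lift by (intro \<pi>_eq) auto
  have lift_hom: "(\<lambda>h. \<pi> (lift h)) \<in> hom (G\<lparr>carrier := H\<rparr>) Q"
  proof (rule homI)
    fix a b assume ab: "a \<in> carrier (G\<lparr>carrier := H\<rparr>)" "b \<in> carrier (G\<lparr>carrier := H\<rparr>)"
    have "\<pi> (lift (a \<otimes> b)) = \<pi> (lift a \<otimes>\<^bsub>Fr\<^esub> lift b)"
      using ab lift subgroup.m_closed[OF H_subgroup] by (intro \<pi>_lift) auto
    also have "lift a \<otimes>\<^bsub>Fr\<^esub> lift b = lift a \<otimes>\<^bsub>Fx\<^esub> lift b" by (simp add: free_group_simps)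
    also have "\<pi> \<dots> = \<pi> (lift a) \<otimes>\<^bsub>Q\<^esub> \<pi> (lift b)"
      using ab lift sub by (intro \<pi>.hom_mult) auto
    finally show "\<pi> (lift (a \<otimes>\<^bsub>G\<lparr>carrier := H\<rparr>\<^esub> b)) = \<pi> (lift a) \<otimes>\<^bsub>Q\<^esub> \<pi> (lift b)" by simp
  next
    fix a assume "a \<in> carrier (G\<lparr>carrier := H\<rparr>)"
    thus "\<pi> (lift a) \<in> carrier Q" using lift sub by (intro \<pi>.hom_closed) auto
  qed
  have x: "[(length hs, True)] \<in> carrier Fx" by (simp add: free_group_simps)
  let ?x = "\<pi> [(length hs, True)]"
  have pow_hom: "(\<lambda>k::int. ?x [^]\<^bsub>Q\<^esub> k) \<in> hom integer_group Q"
    using Q.hom_integer_group_pow x by simp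
  define \<theta> where "\<theta> = copair Q (\<lambda>h. \<pi> (lift h)) (\<lambda>k::int. ?x [^]\<^bsub>Q\<^esub> k)"
  have \<theta>_hom: "\<theta> \<in> hom E Q"
    unfolding \<theta>_def eqn_group_eq
    by (rule copair_hom[OF group_H group_integer_group Q.group_axioms lift_hom pow_hom])
  have \<theta>_const: "\<theta> (eqn_const G (hs ! i)) = \<pi> [(i, True)]" if "i < length hs" for i
  proof -
    have h: "hs ! i \<in> H" using that hs_H by (auto simp: subset_eq)
    have "\<theta> (eqn_const G (hs ! i)) = \<pi> (lift (hs ! i))"
      unfolding \<theta>_def eqn_const_eq
      using h by (intro copair_fp_inl[OF group_H Q.group_axioms lift_hom]) simp
    also have "\<dots> = \<pi> [(i, True)]"
      using that hs_carrier by (intro \<pi>_lift h) (auto simp: free_group_simps subset_eq)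
    finally show ?thesis .
  qed
  have \<theta>_var: "\<theta> eqn_var = ?x"
    unfolding \<theta>_def eqn_var_eq
    using copair_fp_inr[OF group_integer_group Q.group_axioms pow_hom, of 1] x by simp
  have gens: "map \<theta> eqn_gens = map (\<lambda>i. \<pi> [(i, True)]) [0..<Suc (length hs)]"
    using \<theta>_const \<theta>_var by (auto intro!: nth_equalityI simp: nth_append less_Suc_eq)
  have \<theta>_to_eqn: "\<theta> (to_eqn w) = \<pi> w" if w: "w \<in> carrier Fx" for w
  proof -
    have "\<theta> (to_eqn w) = word_eval Q (map \<theta> eqn_gens) w"
      using w by (intro hom_word_eval[OF E.group_axioms Q.group_axioms \<theta>_hom eqn_gens_carrier])
        (simp add: free_group_simps)
    also have "\<dots> = \<pi> w"
      unfolding gens by (rule hom_free_group_eq_word_eval[OF Q.group_axioms \<pi>_hom w, symmetric])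
    finally show ?thesis .
  qed
  show "kernel Fx E to_eqn \<subseteq> ?N"
  proof
    fix w assume "w \<in> kernel Fx E to_eqn"
    hence w: "w \<in> carrier Fx" "to_eqn w = \<one>\<^bsub>E\<^esub>" by (auto simp: kernel_def)
    interpret \<theta>: group_hom E Q \<theta> using \<theta>_hom by unfold_locales
    have "\<pi> w = \<one>\<^bsub>Q\<^esub>" using \<theta>_to_eqn[OF w(1)] w(2) \<theta>.hom_one by simp
    thus "w \<in> ?N" using \<pi>_one w(1) by blast
  qed
qed

text \<open>Substituting \<open>g\<close> for \<open>x\<close> after \<open>to_eqn\<close> is the canonical map of \<open>\<F>\<^sub>r\<^sub>+\<^sub>1\<close> to \<open>\<langle>H, g\<rangle>\<close>. Hence
  the ideal of \<open>g\<close> pulls back to the relations among \<open>h\<^sub>0, \<dots>, h\<^sub>r\<^sub>-\<^sub>1, g\<close>.\<close>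

lemma eqn_eval_to_eqn:
  assumes g: "g \<in> carrier G" and w: "w \<in> words {..<Suc (length hs)}"
  shows "eqn_eval G g (to_eqn w) = word_eval G (hs @ [g]) w"
proof -
  have ev: "eqn_eval G g = copair G (\<lambda>h. h) (\<lambda>k::int. g [^] k)"
    by (simp add: fun_eq_iff eqn_eval_def copair_def)
  have id_hom: "(\<lambda>h. h) \<in> hom (G\<lparr>carrier := H\<rparr>) G"
    using subgroup.subset[OF H_subgroup] by (auto simp: hom_def)
  have pow_hom: "(\<lambda>k::int. g [^] k) \<in> hom integer_group G"
    by (rule hom_integer_group_pow[OF g])
  have ev_hom: "eqn_eval G g \<in> hom E G"
    unfolding ev eqn_group_eq
    by (rule copair_hom[OF group_H group_integer_group group_axioms id_hom pow_hom])
  have "eqn_eval G g (eqn_const G h) = h" if "h \<in> H" for h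
    using that unfolding ev eqn_const_eq
    by (intro copair_fp_inl[OF group_H group_axioms id_hom]) simp
  moreover have "eqn_eval G g eqn_var = g"
    unfolding ev eqn_var_eq
    using copair_fp_inr[OF group_integer_group group_axioms pow_hom, of 1] g by simp
  ultimately have "map (eqn_eval G g) eqn_gens = hs @ [g]"
    using hs_H by (auto intro!: map_idI)
  thus ?thesis
    using hom_word_eval[OF E.group_axioms group_axioms ev_hom eqn_gens_carrier, of w] w by simp
qed

lemma vimage_eqn_ideal:
  assumes "g \<in> carrier G"
  shows "{w \<in> carrier Fx. to_eqn w \<in> eqn_ideal G H g} =
    {w \<in> carrier Fx. word_eval G (hs @ [g]) w = \<one>}"
  using to_eqn_image assms by (auto simp: eqn_ideal_def eqn_eval_to_eqn free_group_simps)

text \<open>The ideal is the image under \<open>to_eqn\<close> of the relations of \<open>\<langle>H, g\<rangle>\<close>, and an epimorphism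
  carries normal closures to normal closures. So a set of defining relators of \<open>\<langle>H, g\<rangle>\<close>, read as
  equations, generates the ideal.\<close>

lemma eqn_ideal_of_presentation:
  assumes g: "g \<in> carrier G" and T: "T \<subseteq> words {..<Suc (length hs)}"
    and pres: "is_presentation (G\<lparr>carrier := generate G (set (hs @ [g]))\<rparr>) (hs @ [g]) (reduce ` T)"
  shows "eqn_ideal G H g = normal_closure E (to_eqn ` T)"
proof -
  have "set (hs @ [g]) \<subseteq> carrier G" using g hs_carrier by simp
  note pres' = pres[unfolded is_presentation_subgroup_iff[OF group_axioms this]]
  have "eqn_ideal G H g = to_eqn ` {w \<in> carrier Fx. to_eqn w \<in> eqn_ideal G H g}"
    using to_eqn_image by (auto simp: eqn_ideal_def)
  also have "\<dots> = to_eqn ` normal_closure Fx (reduce ` T)"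
    unfolding vimage_eqn_ideal[OF g] using pres' by simp
  also have "\<dots> = normal_closure E (to_eqn ` reduce ` T)"
    using pres' by (intro image_normal_closure group_free_group E.group_axioms to_eqn_hom
      to_eqn_image) auto
  also have "to_eqn ` reduce ` T = to_eqn ` T"
    unfolding image_image using T eqn_gens_carrier
    by (intro image_cong refl E.word_eval_reduce) auto
  finally show ?thesis .
qed

text \<open>Conversely the relations of \<open>\<langle>H, g\<rangle>\<close> are the preimage of the ideal, and a preimage needs, besides
  lifts of the generators of the ideal, the kernel of \<open>to_eqn\<close>; that kernel is generated by
  relators of \<open>H\<close>. This is how a presentation is extended by one generator.\<close>

lemma presentation_of_eqn_ideal:
  assumes g: "g \<in> carrier G" and T: "finite T" "T \<subseteq> words {..<Suc (length hs)}"
    and R: "is_presentation (G\<lparr>carrier := H\<rparr>) hs R"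
    and ideal: "eqn_ideal G H g = normal_closure E (to_eqn ` T)"
  shows "is_presentation (G\<lparr>carrier := generate G (set (hs @ [g]))\<rparr>) (hs @ [g]) (R \<union> reduce ` T)"
proof -
  have hsg: "set (hs @ [g]) \<subseteq> carrier G" using g hs_carrier by simp
  note R' = R[unfolded is_presentation_subgroup_iff[OF group_axioms hs_carrier]]
  have Rx: "R \<subseteq> carrier Fx" using R' Fr_subset by blast
  have Tx: "reduce ` T \<subseteq> carrier Fx" using T by (auto intro: reduce_in_free_group)
  have "to_eqn ` reduce ` T = to_eqn ` T"
    unfolding image_image using T eqn_gens_carrier
    by (intro image_cong refl E.word_eval_reduce) auto
  hence "{w \<in> carrier Fx. word_eval G (hs @ [g]) w = \<one>} =
      {w \<in> carrier Fx. to_eqn w \<in> normal_closure E (to_eqn ` reduce ` T)}"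
    using vimage_eqn_ideal[OF g] ideal by simp
  also have "\<dots> = normal_closure Fx (R \<union> reduce ` T)"
    by (rule vimage_normal_closure[OF group_free_group E.group_axioms to_eqn_hom to_eqn_image
          Tx Rx to_eqn_kernel[OF R]])
  finally show ?thesis
    unfolding is_presentation_subgroup_iff[OF group_axioms hsg] using R' T Rx Tx by simp
qed

end


section \<open>Coherence and equational coherence\<close>

lemma is_presentation_trivial:
  assumes "group G"
  shows "is_presentation (G\<lparr>carrier := generate G (set [])\<rparr>) [] {}"
proof -
  have F: "carrier (free_group {..<0::nat}) = {[]}"
    by (auto simp: free_group_simps words_def)
  have "normal_closure (free_group {..<0::nat}) {} = {[]}"
  proof
    have N: "normal_closure (free_group {..<0::nat}) {} \<lhd> free_group {..<0}"
      by (intro normal_closure_normal group_free_group) simp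
    interpret N: normal "normal_closure (free_group {..<0::nat}) {}" "free_group {..<0}" by fact
    show "normal_closure (free_group {..<0::nat}) {} \<subseteq> {[]}" using N.subset F by simp
    have "[] \<in> normal_closure (free_group {..<0::nat}) {}"
      using subgroup.one_closed[OF N.subgroup_axioms] by (simp only: free_group_simps(3))
    thus "{[]} \<subseteq> normal_closure (free_group {..<0::nat}) {}" by blast
  qed
  moreover have "{w \<in> carrier (free_group {..<0}). word_eval G [] w = \<one>\<^bsub>G\<^esub>} = {[]}"
    unfolding F by auto
  moreover have gens: "set [] \<subseteq> carrier G" by simp
  ultimately show ?thesis
    unfolding is_presentation_subgroup_iff[OF assms gens] list.size by blast
qed

text \<open>Coherence gives \<open>\<langle>H, g\<rangle>\<close> a finite presentation on some generators; it has to be moved to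
  \<open>h\<^sub>0, \<dots>, h\<^sub>r\<^sub>-\<^sub>1, g\<close> before its relators can be read as equations over \<open>H\<close>.\<close>

lemma coherent_imp_eq_coherent:
  assumes "group G" "coherent G"
  shows "eq_coherent G"
  unfolding eq_coherent_def
proof (intro conjI allI impI)
  show "finitely_presented G" using assms(2) by (simp add: coherent_def)
  fix H g assume "fg_subgroup H G" and g: "g \<in> carrier G"
  then obtain hs where hs: "set hs \<subseteq> carrier G" "H = generate G (set hs)"
    unfolding fg_subgroup_def by (metis finite_list)
  interpret subgroup_gens G hs
    using assms(1) hs(1) by (simp add: subgroup_gens_def subgroup_gens_axioms_def)
  let ?K = "generate G (set (hs @ [g]))"
  have hsg: "set (hs @ [g]) \<subseteq> carrier G" using hs g by simp
  have K: "subgroup ?K G" by (rule generate_is_subgroup[OF hsg])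
  have hsK: "set (hs @ [g]) \<subseteq> ?K" by (auto intro: generate.incl)
  have "fg_subgroup ?K G" unfolding fg_subgroup_def using hsg by blast
  then obtain ys S where "is_presentation (G\<lparr>carrier := ?K\<rparr>) ys S"
    using assms(2) unfolding coherent_def finitely_presented_def by blast
  then obtain T where T: "is_presentation (G\<lparr>carrier := ?K\<rparr>) (hs @ [g]) T"
    using is_presentation_change_gens[OF subgroup_imp_group[OF K], of ys S "hs @ [g]"]
      hsK generate_consistent[OF hsK K] by auto
  hence fin: "finite T" and Tx: "T \<subseteq> carrier Fx"
    by (auto simp: is_presentation_def)
  have "reduce ` T = T" using Tx by (force simp: free_group_simps reduce_reduced)
  hence "eqn_ideal G (generate G (set hs)) g = normal_closure E (to_eqn ` T)"
    using T Tx by (intro eqn_ideal_of_presentation g) (auto simp: free_group_simps)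
  moreover have "to_eqn ` T \<subseteq> carrier E" using Tx to_eqn_image by blast
  ultimately show "\<exists>W. finite W \<and> W \<subseteq> carrier (eqn_group G H) \<and>
      eqn_ideal G H g = normal_closure (eqn_group G H) W"
    unfolding hs(2) using fin by blast
qed

text \<open>A presentation of \<open>\<langle>h\<^sub>0, \<dots>, h\<^sub>r\<^sub>-\<^sub>1\<rangle>\<close> is built up from the trivial group by adjoining the
  generators one at a time: \<open>h\<^sub>i\<close> contributes the generators of its ideal over
  \<open>\<langle>h\<^sub>0, \<dots>, h\<^sub>i\<^sub>-\<^sub>1\<rangle>\<close>.\<close>

lemma eq_coherent_imp_coherent:
  assumes "group G" "eq_coherent G"
  shows "coherent G"
proof -
  interpret group G by fact
  have "\<exists>R. is_presentation (G\<lparr>carrier := generate G (set hs)\<rparr>) hs R"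
    if "set hs \<subseteq> carrier G" for hs
    using that
  proof (induction hs rule: rev_induct)
    case Nil
    show ?case using is_presentation_trivial[OF assms(1)] by blast
  next
    case (snoc g hs)
    then obtain R where R: "is_presentation (G\<lparr>carrier := generate G (set hs)\<rparr>) hs R" by auto
    interpret subgroup_gens G hs
      using snoc.prems by unfold_locales simp
    have "fg_subgroup (generate G (set hs)) G"
      unfolding fg_subgroup_def using hs_carrier by blast
    moreover have g: "g \<in> carrier G" using snoc.prems by simp
    ultimately obtain W where W: "finite W" "W \<subseteq> carrier E"
      "eqn_ideal G (generate G (set hs)) g = normal_closure E W"
      using assms(2) unfolding eq_coherent_def by blast
    obtain T where "T \<subseteq> carrier Fx" "finite T" "W = to_eqn ` T"
      using finite_subset_image[of W to_eqn "carrier Fx"] W to_eqn_image by auto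
    thus ?case
      using presentation_of_eqn_ideal[OF g _ _ R, of T] W by (auto simp: free_group_simps)
  qed
  hence "finitely_presented (G\<lparr>carrier := H\<rparr>)" if "fg_subgroup H G" for H
    using that unfolding fg_subgroup_def finitely_presented_def by (metis finite_list)
  thus ?thesis using assms(2) by (simp add: coherent_def eq_coherent_def)
qed


section \<open>The algorithms\<close>

lemma computes_snoc_encode_words:
  "computes snoc_prog [encode_words us, encode_word v] (encode_words (us @ [v]))"
  unfolding encode_words_def by (simp add: computes_snoc)

text \<open>Running the presentation algorithm on the generators of \<open>H\<close> followed by \<open>g\<close> already answers the
  question: the last letter of its output stands for \<open>g\<close> in the one reading and for \<open>x\<close> in the
  other.\<close>

lemma effectively_coherent_imp_effectively_eq_coherent:
  assumes "group G" "set as \<subseteq> carrier G" "effectively_coherent G as"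
  shows "effectively_eq_coherent G as"
proof -
  interpret group G by fact
  obtain p where p: "\<And>us. set us \<subseteq> words {..<length as} \<Longrightarrow>
        (\<exists>ws. computes p [encode_words us] (encode_words ws) \<and>
              set ws \<subseteq> words {..<length us} \<and>
              (let hs = map (word_eval G as) us
               in is_presentation (G\<lparr>carrier := generate G (set hs)\<rparr>) hs (reduce ` set ws)))"
    using assms(3) unfolding effectively_coherent_def by blast
  have "\<exists>ws. computes (Comp p [snoc_prog]) [encode_words us, encode_word v] (encode_words ws) \<and>
              set ws \<subseteq> words {..<Suc (length us)} \<and>
              (let hs = map (word_eval G as) us;
                   H = generate G (set hs);
                   W = word_eval (eqn_group G H) (map (eqn_const G) hs @ [eqn_var]) ` set ws
               in eqn_ideal G H (word_eval G as v) = normal_closure (eqn_group G H) W)"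
    if us: "set us \<subseteq> words {..<length as}" and v: "v \<in> words {..<length as}" for us v
  proof -
    let ?hs = "map (word_eval G as) us" and ?g = "word_eval G as v"
    obtain ws where ws: "computes p [encode_words (us @ [v])] (encode_words ws)"
      "set ws \<subseteq> words {..<Suc (length us)}"
      "is_presentation (G\<lparr>carrier := generate G (set (?hs @ [?g]))\<rparr>) (?hs @ [?g]) (reduce ` set ws)"
      using p[of "us @ [v]"] us v by (auto simp: Let_def)
    interpret subgroup_gens G ?hs
      by unfold_locales (use us assms(2) in \<open>auto intro: word_eval_closed\<close>)
    have "eqn_ideal G (generate G (set ?hs)) ?g = normal_closure E (to_eqn ` set ws)"
      using ws v assms(2) by (intro eqn_ideal_of_presentation word_eval_closed) auto
    thus ?thesis
      using computes_Comp1[OF computes_snoc_encode_words ws(1)] ws(2) by (auto simp: Let_def)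
  qed
  moreover have "eq_coherent G"
    using assms(1,3) by (simp add: effectively_coherent_def coherent_imp_eq_coherent)
  ultimately show ?thesis unfolding effectively_eq_coherent_def by blast
qed

text \<open>The inductive construction of a presentation is uniform: the relators contributed by \<open>h\<^sub>i\<close> are
  the output of the ideal algorithm on \<open>h\<^sub>0, \<dots>, h\<^sub>i\<^sub>-\<^sub>1; h\<^sub>i\<close>. That output is written in
  \<open>x\<^sub>0, \<dots>, x\<^sub>i\<close> with \<open>x\<^sub>i\<close> for the variable, which is the letter of \<open>h\<^sub>i\<close> in the final presentation,
  so the outputs only have to be collected.\<close>

lemma effectively_eq_coherent_imp_effectively_coherent:
  assumes "group G" "set as \<subseteq> carrier G" "effectively_eq_coherent G as"
  shows "effectively_coherent G as"
proof -
  interpret group G by fact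
  define good where "good = (\<lambda>us v ws. set ws \<subseteq> words {..<Suc (length us)} \<and>
      (let hs = map (word_eval G as) us;
           H = generate G (set hs);
           W = word_eval (eqn_group G H) (map (eqn_const G) hs @ [eqn_var]) ` set ws
       in eqn_ideal G H (word_eval G as v) = normal_closure (eqn_group G H) W))"
  obtain p where p: "\<And>us v. set us \<subseteq> words {..<length as} \<Longrightarrow> v \<in> words {..<length as} \<Longrightarrow>
        \<exists>ws. computes p [encode_words us, encode_word v] (encode_words ws) \<and> good us v ws"
    using assms(3) unfolding effectively_eq_coherent_def good_def by blast
  have "\<exists>ws. computes (scan_prog p) [encode_words us] (encode_words ws) \<and>
              set ws \<subseteq> words {..<length us} \<and>
              (let hs = map (word_eval G as) us
               in is_presentation (G\<lparr>carrier := generate G (set hs)\<rparr>) hs (reduce ` set ws))"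
    if us: "set us \<subseteq> words {..<length as}" for us
  proof -
    have "\<forall>i. \<exists>ws. i < length us \<longrightarrow> computes p [encode_words (take i us), encode_word (us ! i)]
        (encode_words ws) \<and> good (take i us) (us ! i) ws"
      using p us by (meson nth_mem set_take_subset subset_iff)
    then obtain rels where rels:
      "\<And>i. i < length us \<Longrightarrow> computes p [encode_words (take i us), encode_word (us ! i)]
        (encode_words (rels i))"
      "\<And>i. i < length us \<Longrightarrow> good (take i us) (us ! i) (rels i)"
      by metis
    define out where "out = concat (map (\<lambda>i. rev (rels i)) (rev [0..<length us]))"
    have set_out: "set out = (\<Union>i<length us. set (rels i))" by (auto simp: out_def)
    have "computes (scan_prog p) [list_encode (map encode_word us)]
        (list_encode (concat (map (\<lambda>i. rev (map encode_word (rels i)))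
          (rev [0..<length (map encode_word us)]))))"
      using rels(1) by (intro computes_scan) (auto simp: encode_words_def take_map)
    moreover have "concat (map (\<lambda>i. rev (map encode_word (rels i)))
        (rev [0..<length (map encode_word us)])) = map encode_word out"
      by (simp add: out_def map_concat rev_map comp_def)
    ultimately have comp: "computes (scan_prog p) [encode_words us] (encode_words out)"
      by (simp add: encode_words_def)
    have words: "set (rels i) \<subseteq> words {..<Suc i}" if "i < length us" for i
      using rels(2)[OF that] that by (simp add: good_def)
    have out_words: "set out \<subseteq> words {..<length us}"
      unfolding set_out using words by (fastforce simp: words_def subset_eq)
    have "is_presentation
        (G\<lparr>carrier := generate G (set (map (word_eval G as) (take n us)))\<rparr>)
        (map (word_eval G as) (take n us)) (reduce ` (\<Union>i<n. set (rels i)))"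
      if "n \<le> length us" for n
      using that
    proof (induction n)
      case 0
      show ?case using is_presentation_trivial[OF assms(1)] by simp
    next
      case (Suc n)
      hence n: "n < length us" by simp
      let ?hs = "map (word_eval G as) (take n us)"
      interpret subgroup_gens G ?hs
        by unfold_locales (use us assms(2) in \<open>auto intro!: word_eval_closed dest: in_set_takeD\<close>)
      have v: "us ! n \<in> words {..<length as}" using us n by (auto simp: subset_eq)
      have "is_presentation
          (G\<lparr>carrier := generate G (set (?hs @ [word_eval G as (us ! n)]))\<rparr>)
          (?hs @ [word_eval G as (us ! n)])
          (reduce ` (\<Union>i<n. set (rels i)) \<union> reduce ` set (rels n))"
      proof (rule presentation_of_eqn_ideal)
        show "word_eval G as (us ! n) \<in> carrier G" by (rule word_eval_closed[OF assms(2) v])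
        show "set (rels n) \<subseteq> words {..<Suc (length ?hs)}" using words[OF n] n by simp
        show "is_presentation (G\<lparr>carrier := generate G (set ?hs)\<rparr>) ?hs
            (reduce ` (\<Union>i<n. set (rels i)))" using Suc by simp
        show "eqn_ideal G (generate G (set ?hs)) (word_eval G as (us ! n)) =
            normal_closure E (to_eqn ` set (rels n))"
          using rels(2)[OF n] by (simp add: good_def Let_def)
      qed simp
      moreover have "?hs @ [word_eval G as (us ! n)] = map (word_eval G as) (take (Suc n) us)"
        using n by (simp add: take_Suc_conv_app_nth)
      moreover have "reduce ` (\<Union>i<n. set (rels i)) \<union> reduce ` set (rels n)
          = reduce ` (\<Union>i<Suc n. set (rels i))"
        by (auto simp: lessThan_Suc)
      ultimately show ?case by (simp only:)
    qed
    from this[of "length us"] show ?thesis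
      using comp out_words by (intro exI[of _ out]) (simp add: Let_def set_out)
  qed
  moreover have "coherent G"
    using assms(1,3) by (simp add: effectively_eq_coherent_def eq_coherent_imp_coherent)
  ultimately show ?thesis unfolding effectively_coherent_def by blast
qed

theorem proposition2p9:
  fixes G :: "('g, 'm) monoid_scheme" and as :: "'g list" and R :: "nat wd set"
  assumes "group G" and "is_presentation G as R"
  shows "(coherent G \<longleftrightarrow> eq_coherent G) \<and>
         (effectively_coherent G as \<longleftrightarrow> effectively_eq_coherent G as)"
proof -
  have "set as \<subseteq> carrier G" using assms(2) by (simp add: is_presentation_def)
  thus ?thesis
    using assms(1) coherent_imp_eq_coherent eq_coherent_imp_coherent
      effectively_coherent_imp_effectively_eq_coherent
      effectively_eq_coherent_imp_effectively_coherent by blast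
qed

end
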